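(* Let $M$ be a smooth manifold of dimension $n$, and let $P_1$ and $P_2$ be Poisson bivectors on $M$, regarded as maps $P_1, P_2 : T^*M \to TM$, which are compatible, i.e., such that $P_1 + P_2$ is also a Poisson bivector. Assume that $P_1$ is invertible and set $R = P_2 \circ P_1^{-1}$, a $(1,1)$-tensor on $M$. Let $X$ be a vector field on $M$ which is bi-hamiltonian with respect to $P_1$ and $P_2$, i.e., there exist smooth functions $H_1, H_2$ on $M$ such that, with $\alpha_1 = \mathrm{d}H_1$ and $\alpha_2 = \mathrm{d}H_2$, $$X = P_1(\alpha_1) = P_2(\alpha_2).$$ Set $\theta = \alpha_1$. Then all the powers $R^k$, $k \geq 0$, have vanishing Haantjes torsion, the vector fields $R^k X$, $k \ge 0$, commute pairwise, and the $1$-forms $\theta R^k$, $k \geq 0$, are closed. Consequently, the commuting $(1,1)$-tensors $R_k = R^{k-1}$, $k = 1, \ldots, n$, together with the pair $(X,\theta)$, define a Magri--Lenard complex on $M$. In addition, $\theta$ and $R$ are invariant under $X$, i.e., $\mathcal{L}_X \theta = 0$ and $\mathcal{L}_X R = 0$.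
   Context: For a $1$-form $\theta$ and a $(1,1)$-tensor $R$ (a field of endomorphisms of the tangent bundle), $\theta R$ denotes the $1$-form $Y \mapsto \theta(RY)$. $\mathcal{L}_X$ denotes the Lie derivative. The Nijenhuis torsion of a $(1,1)$-tensor $R$ is the $(1,2)$-tensor $$\mathcal{T}_R(Y,Z) = [RY,RZ] - R[RY,Z] - R[Y,RZ] + R^2[Y,Z],$$ for vector fields $Y, Z$, and the Haantjes torsion of $R$ is the $(1,2)$-tensor $$\mathcal{H}_R(Y,Z) = \mathcal{T}_R(RY,RZ) - R(\mathcal{T}_R(RY,Z)) - R(\mathcal{T}_R(Y,RZ)) + R^2(\mathcal{T}_R(Y,Z)).$$ A Magri--Lenard complex on a manifold $M$ of dimension $n$ equipped with $n$ pairwise commuting $(1,1)$-tensors $R_1 = \mathrm{Id}, R_2, \ldots, R_n$ is defined by a pair $(X,\theta)$, where $X$ is a vector field and $\theta$ is a $1$-form, such that (i) the vector fields $R_k X$, $k = 1, \ldots, n$, commute pairwise (their Lie brackets vanish), and (ii) the $1$-forms $\theta R_k R_\ell$, $k, \ell = 1, \ldots, n$, are closed. *)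

theory Defs
  imports "HOL-Analysis.Analysis" "HOL-Library.Function_Algebras"
begin

text \<open>Function spaces are real vector spaces pointwise; tangent vectors and covectors below
  are elements of such spaces.\<close>

instantiation "fun" :: (type, real_vector) real_vector
begin

definition scaleR_fun :: "real \<Rightarrow> ('a \<Rightarrow> 'b) \<Rightarrow> 'a \<Rightarrow> 'b"
  where "scaleR_fun c f = (\<lambda>x. c *\<^sub>R f x)"

instance
  by standard (simp_all add: scaleR_fun_def plus_fun_def scaleR_add_right scaleR_add_left)

end

definition linear_on_subspace :: "'a::real_vector set \<Rightarrow> ('a \<Rightarrow> 'b::real_vector) \<Rightarrow> bool"
  where "linear_on_subspace V L \<longleftrightarrow>
    (\<forall>v\<in>V. \<forall>w\<in>V. \<forall>a b. L (a *\<^sub>R v + b *\<^sub>R w) = a *\<^sub>R L v + b *\<^sub>R L w)"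


section \<open>Smooth manifolds\<close>

text \<open>\<open>Ck_on k f S\<close>, meant for open \<open>S\<close>: \<open>f\<close> is \<open>k\<close> times continuously
  differentiable on \<open>S\<close>.\<close>

fun Ck_on :: "nat \<Rightarrow> ('a::real_normed_vector \<Rightarrow> 'b::real_normed_vector) \<Rightarrow> 'a set \<Rightarrow> bool" where
  "Ck_on 0 f S \<longleftrightarrow> continuous_on S f"
| "Ck_on (Suc k) f S \<longleftrightarrow>
     (\<forall>x\<in>S. f differentiable (at x)) \<and>
     (\<forall>v. Ck_on k (\<lambda>x. frechet_derivative f (at x) v) S)"

definition smooth_on :: "('a::real_normed_vector \<Rightarrow> 'b::real_normed_vector) \<Rightarrow> 'a set \<Rightarrow> bool"
  where "smooth_on f S \<longleftrightarrow> (\<forall>k. Ck_on k f S)"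

text \<open>The manifold is a whole type \<open>'m\<close> with its topology (Hausdorff and second countable by its
  sort), modelled on the Euclidean space \<open>'e\<close>; its dimension is \<open>DIM('e)\<close>, hence positive. A chart is a pair
  consisting of an open domain and a coordinate map, of which only the restriction to the domain
  matters. The atlas need not be maximal.\<close>

type_synonym ('m, 'e) chart = "'m set \<times> ('m \<Rightarrow> 'e)"

definition smooth_manifold ::
    "('m::{t2_space, second_countable_topology}, 'e::euclidean_space) chart set \<Rightarrow> bool"
  where "smooth_manifold A \<longleftrightarrow>
    (\<forall>(U, \<phi>)\<in>A. open U \<and> open (\<phi> ` U) \<and> inj_on \<phi> U \<and>
        homeomorphism U (\<phi> ` U) \<phi> (inv_into U \<phi>)) \<and>
    (\<Union>(U, \<phi>)\<in>A. U) = UNIV \<and>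
    (\<forall>(U, \<phi>)\<in>A. \<forall>(V, \<psi>)\<in>A. smooth_on (\<psi> \<circ> inv_into U \<phi>) (\<phi> ` (U \<inter> V)))"

definition smooth_fun :: "('m, 'e::euclidean_space) chart set \<Rightarrow> ('m \<Rightarrow> real) \<Rightarrow> bool"
  where "smooth_fun A f \<longleftrightarrow> (\<forall>(U, \<phi>)\<in>A. smooth_on (f \<circ> inv_into U \<phi>) (\<phi> ` U))"


section \<open>Tangent and cotangent spaces\<close>

text \<open>A tangent vector at \<open>p\<close> is a derivation at \<open>p\<close> of the algebra of smooth functions. So that
  equality of derivations is equality in the logic, they vanish on non-smooth arguments; likewise
  covectors at \<open>p\<close> vanish outside the tangent space at \<open>p\<close>.\<close>

type_synonym 'm tvec = "('m \<Rightarrow> real) \<Rightarrow> real"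
type_synonym 'm covec = "'m tvec \<Rightarrow> real"

definition tangent_space :: "('m, 'e::euclidean_space) chart set \<Rightarrow> 'm \<Rightarrow> 'm tvec set"
  where "tangent_space A p = {v.
    linear_on_subspace {f. smooth_fun A f} v \<and>
    (\<forall>f g. smooth_fun A f \<longrightarrow> smooth_fun A g \<longrightarrow>
       v (\<lambda>q. f q * g q) = f p * v g + g p * v f) \<and>
    (\<forall>f. \<not> smooth_fun A f \<longrightarrow> v f = 0)}"

definition cotangent_space :: "('m, 'e::euclidean_space) chart set \<Rightarrow> 'm \<Rightarrow> 'm covec set"
  where "cotangent_space A p = {\<alpha>.
    linear_on_subspace (tangent_space A p) \<alpha> \<and> (\<forall>v. v \<notin> tangent_space A p \<longrightarrow> \<alpha> v = 0)}"


section \<open>Vector fields, 1-forms and (1,1)-tensors\<close>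

type_synonym 'm vfield = "'m \<Rightarrow> 'm tvec"
type_synonym 'm form1 = "'m \<Rightarrow> 'm covec"
type_synonym 'm endo = "'m \<Rightarrow> 'm tvec \<Rightarrow> 'm tvec"

definition vector_field :: "('m, 'e::euclidean_space) chart set \<Rightarrow> 'm vfield \<Rightarrow> bool"
  where "vector_field A X \<longleftrightarrow>
    (\<forall>p. X p \<in> tangent_space A p) \<and>
    (\<forall>f. smooth_fun A f \<longrightarrow> smooth_fun A (\<lambda>p. X p f))"

definition one_form :: "('m, 'e::euclidean_space) chart set \<Rightarrow> 'm form1 \<Rightarrow> bool"
  where "one_form A \<theta> \<longleftrightarrow>
    (\<forall>p. \<theta> p \<in> cotangent_space A p) \<and>
    (\<forall>X. vector_field A X \<longrightarrow> smooth_fun A (\<lambda>p. \<theta> p (X p)))"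

definition app_field :: "'m endo \<Rightarrow> 'm vfield \<Rightarrow> 'm vfield" (infixr "\<cdot>" 75)
  where "R \<cdot> X = (\<lambda>p. R p (X p))"

definition tensor11 :: "('m, 'e::euclidean_space) chart set \<Rightarrow> 'm endo \<Rightarrow> bool"
  where "tensor11 A R \<longleftrightarrow>
    (\<forall>p. linear_on_subspace (tangent_space A p) (R p) \<and>
         R p ` tangent_space A p \<subseteq> tangent_space A p) \<and>
    (\<forall>X. vector_field A X \<longrightarrow> vector_field A (R \<cdot> X))"

definition tensor_power :: "'m endo \<Rightarrow> nat \<Rightarrow> 'm endo"
  where "tensor_power R k = (\<lambda>p. R p ^^ k)"

definition tensor_comp :: "'m endo \<Rightarrow> 'm endo \<Rightarrow> 'm endo"
  where "tensor_comp R S = (\<lambda>p. R p \<circ> S p)"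

definition form_comp :: "('m, 'e::euclidean_space) chart set \<Rightarrow> 'm form1 \<Rightarrow> 'm endo \<Rightarrow> 'm form1"
  where "form_comp A \<theta> R = (\<lambda>p v. if v \<in> tangent_space A p then \<theta> p (R p v) else 0)"

definition differential :: "('m, 'e::euclidean_space) chart set \<Rightarrow> ('m \<Rightarrow> real) \<Rightarrow> 'm form1"
  where "differential A f = (\<lambda>p v. if v \<in> tangent_space A p then v f else 0)"

definition lie_bracket ::
    "('m, 'e::euclidean_space) chart set \<Rightarrow> 'm vfield \<Rightarrow> 'm vfield \<Rightarrow> 'm vfield"
  where "lie_bracket A X Y = (\<lambda>p f.
    if smooth_fun A f then X p (\<lambda>q. Y q f) - Y p (\<lambda>q. X q f) else 0)"

definition ext_deriv1 ::
    "('m, 'e::euclidean_space) chart set \<Rightarrow> 'm form1 \<Rightarrow> 'm vfield \<Rightarrow> 'm vfield \<Rightarrow> 'm \<Rightarrow> real"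
  where "ext_deriv1 A \<theta> Y Z = (\<lambda>p.
    Y p (\<lambda>q. \<theta> q (Z q)) - Z p (\<lambda>q. \<theta> q (Y q)) - \<theta> p (lie_bracket A Y Z p))"

definition closed_form :: "('m, 'e::euclidean_space) chart set \<Rightarrow> 'm form1 \<Rightarrow> bool"
  where "closed_form A \<theta> \<longleftrightarrow> one_form A \<theta> \<and>
    (\<forall>Y Z. vector_field A Y \<longrightarrow> vector_field A Z \<longrightarrow> ext_deriv1 A \<theta> Y Z = 0)"

text \<open>Lie derivatives are given by the Leibniz rule: \<open>(\<L>\<^sub>X\<theta>)(Y) = X(\<theta>(Y)) - \<theta>([X, Y])\<close> and
  \<open>(\<L>\<^sub>XR)(Y) = [X, RY] - R[X, Y]\<close>.\<close>

definition lie_deriv_form ::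
    "('m, 'e::euclidean_space) chart set \<Rightarrow> 'm vfield \<Rightarrow> 'm form1 \<Rightarrow> 'm vfield \<Rightarrow> 'm \<Rightarrow> real"
  where "lie_deriv_form A X \<theta> Y = (\<lambda>p.
    X p (\<lambda>q. \<theta> q (Y q)) - \<theta> p (lie_bracket A X Y p))"

definition lie_deriv_tensor ::
    "('m, 'e::euclidean_space) chart set \<Rightarrow> 'm vfield \<Rightarrow> 'm endo \<Rightarrow> 'm vfield \<Rightarrow> 'm vfield"
  where "lie_deriv_tensor A X R Y = lie_bracket A X (R \<cdot> Y) - R \<cdot> lie_bracket A X Y"

definition nijenhuis_torsion ::
    "('m, 'e::euclidean_space) chart set \<Rightarrow> 'm endo \<Rightarrow> 'm vfield \<Rightarrow> 'm vfield \<Rightarrow> 'm vfield"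
  where "nijenhuis_torsion A R Y Z =
    lie_bracket A (R \<cdot> Y) (R \<cdot> Z) - R \<cdot> lie_bracket A (R \<cdot> Y) Z
    - R \<cdot> lie_bracket A Y (R \<cdot> Z) + R \<cdot> R \<cdot> lie_bracket A Y Z"

definition haantjes_torsion ::
    "('m, 'e::euclidean_space) chart set \<Rightarrow> 'm endo \<Rightarrow> 'm vfield \<Rightarrow> 'm vfield \<Rightarrow> 'm vfield"
  where "haantjes_torsion A R Y Z =
    nijenhuis_torsion A R (R \<cdot> Y) (R \<cdot> Z) - R \<cdot> nijenhuis_torsion A R (R \<cdot> Y) Z
    - R \<cdot> nijenhuis_torsion A R Y (R \<cdot> Z) + R \<cdot> R \<cdot> nijenhuis_torsion A R Y Z"

definition haantjes_torsion_free :: "('m, 'e::euclidean_space) chart set \<Rightarrow> 'm endo \<Rightarrow> bool"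
  where "haantjes_torsion_free A R \<longleftrightarrow>
    (\<forall>Y Z. vector_field A Y \<longrightarrow> vector_field A Z \<longrightarrow> haantjes_torsion A R Y Z = 0)"


section \<open>Poisson bivectors\<close>

text \<open>A bivector is regarded as a skew-symmetric bundle map \<open>P\<close> from the cotangent to the tangent
  bundle; it is Poisson if the bracket \<open>{f, g} = dg(P(df)) = (P(df)) g\<close> satisfies the Jacobi
  identity.\<close>

type_synonym 'm bivec = "'m \<Rightarrow> 'm covec \<Rightarrow> 'm tvec"

definition bivector :: "('m, 'e::euclidean_space) chart set \<Rightarrow> 'm bivec \<Rightarrow> bool"
  where "bivector A P \<longleftrightarrow>
    (\<forall>p. linear_on_subspace (cotangent_space A p) (P p) \<and>
         P p ` cotangent_space A p \<subseteq> tangent_space A p \<and>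
         (\<forall>\<alpha>\<in>cotangent_space A p. \<forall>\<beta>\<in>cotangent_space A p. \<beta> (P p \<alpha>) = - \<alpha> (P p \<beta>))) \<and>
    (\<forall>\<alpha>. one_form A \<alpha> \<longrightarrow> vector_field A (\<lambda>p. P p (\<alpha> p)))"

definition poisson_bracket ::
    "('m, 'e::euclidean_space) chart set \<Rightarrow> 'm bivec \<Rightarrow> ('m \<Rightarrow> real) \<Rightarrow> ('m \<Rightarrow> real) \<Rightarrow> 'm \<Rightarrow> real"
  where "poisson_bracket A P f g = (\<lambda>p. differential A g p (P p (differential A f p)))"

definition poisson_bivector :: "('m, 'e::euclidean_space) chart set \<Rightarrow> 'm bivec \<Rightarrow> bool"
  where "poisson_bivector A P \<longleftrightarrow> bivector A P \<and>
    (\<forall>f g h. smooth_fun A f \<longrightarrow> smooth_fun A g \<longrightarrow> smooth_fun A h \<longrightarrow>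
       poisson_bracket A P f (poisson_bracket A P g h)
       + poisson_bracket A P g (poisson_bracket A P h f)
       + poisson_bracket A P h (poisson_bracket A P f g) = 0)"

definition invertible_bivector :: "('m, 'e::euclidean_space) chart set \<Rightarrow> 'm bivec \<Rightarrow> bool"
  where "invertible_bivector A P \<longleftrightarrow>
    (\<forall>p. bij_betw (P p) (cotangent_space A p) (tangent_space A p))"

definition bivector_inverse ::
    "('m, 'e::euclidean_space) chart set \<Rightarrow> 'm bivec \<Rightarrow> 'm \<Rightarrow> 'm tvec \<Rightarrow> 'm covec"
  where "bivector_inverse A P = (\<lambda>p. inv_into (cotangent_space A p) (P p))"


section \<open>Magri--Lenard complexes\<close>

text \<open>The tensors are \<open>R 1, \<dots>, R n\<close> with \<open>n\<close> the dimension of the manifold; other values of \<open>R\<close>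
  play no role. The values of a (1,1)-tensor at \<open>p\<close> matter only on the tangent space at \<open>p\<close>.\<close>

definition magri_lenard ::
    "('m, 'e::euclidean_space) chart set \<Rightarrow> (nat \<Rightarrow> 'm endo) \<Rightarrow> 'm vfield \<Rightarrow> 'm form1 \<Rightarrow> bool"
  where "magri_lenard A R X \<theta> \<longleftrightarrow>
    (\<forall>k\<in>{1..DIM('e)}. tensor11 A (R k)) \<and>
    (\<forall>p. \<forall>v\<in>tangent_space A p. R 1 p v = v) \<and>
    (\<forall>k\<in>{1..DIM('e)}. \<forall>l\<in>{1..DIM('e)}. \<forall>p. \<forall>v\<in>tangent_space A p.
        R k p (R l p v) = R l p (R k p v)) \<and>
    vector_field A X \<and> one_form A \<theta> \<and>
    (\<forall>k\<in>{1..DIM('e)}. \<forall>l\<in>{1..DIM('e)}. lie_bracket A (R k \<cdot> X) (R l \<cdot> X) = 0) \<and>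
    (\<forall>k\<in>{1..DIM('e)}. \<forall>l\<in>{1..DIM('e)}.
        closed_form A (form_comp A \<theta> (tensor_comp (R k) (R l))))"

end

theory Submission
  imports Defs
begin

text \<open>
  The recursion operator \<open>R = P\<^sub>2 \<circ> P\<^sub>1\<inverse>\<close> of a Poisson pencil has vanishing Nijenhuis torsion, and
  everything else follows from this by formal manipulation of brackets.

  Let \<open>X\<^sub>f = P\<^sub>1(df)\<close> and \<open>Y\<^sub>f = P\<^sub>2(df)\<close>, so that \<open>R X\<^sub>f = Y\<^sub>f\<close>. The Jacobi identity says
  \<open>[X\<^sub>f, X\<^sub>g] = X\<^sub>h\<close> for \<open>h = P\<^sub>1(df)(g)\<close> (\<open>hamiltonian_bracket\<close>), and polarizing this
  identity for \<open>P\<^sub>1 + P\<^sub>2\<close> gives a formula for \<open>[X\<^sub>f, Y\<^sub>g] + [Y\<^sub>f, X\<^sub>g]\<close>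
  (\<open>hamiltonian_bracket_mixed\<close>). Inserted in the torsion of \<open>R\<close> at \<open>(X\<^sub>f, X\<^sub>g)\<close> all terms cancel.
  As the torsion is a tensor and every tangent vector is the value of some \<open>X\<^sub>f\<close>, because \<open>P\<^sub>1\<close> is
  invertible, it vanishes identically (\<open>recursion_torsion\<close>). The same argument shows
  \<open>\<L>\<^sub>X R = 0\<close>: both \<open>P\<^sub>1\<close> and \<open>P\<^sub>2\<close> turn the bracket with \<open>X\<close> into the derivative along \<open>X\<close>
  (\<open>X_preserves_recursion\<close>).

  Vanishing torsion allows powers of \<open>R\<close> to be pulled out of brackets
  (\<open>bracket_power_power\<close>). With equal exponents this is the vanishing of the Nijenhuis torsion, a
  fortiori of the Haantjes torsion, of \<open>R\<^sup>k\<close>; applied to \<open>X\<close> it shows, together with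
  \<open>\<L>\<^sub>X R = 0\<close>, that the fields \<open>R\<^sup>kX\<close> commute.
  For the forms, \<open>dH\<^sub>1 = dH\<^sub>2 \<circ> R\<close> by skew-symmetry, so that \<open>dH\<^sub>2\<close> and \<open>dH\<^sub>2 \<circ> R\<close> are both
  closed, and for a torsion-free \<open>R\<close> two consecutive closed forms of the sequence \<open>\<eta> \<circ> R\<^sup>k\<close> make the
  next one closed (\<open>closed_form_step\<close>).

  These arguments rest on local facts about derivations: near each point there are coordinate functions whose
  differentials span the cotangent spaces. The coordinates and the dual fields are cut off by a bump
  function \<open>\<kappa>\<close> so that they live on the whole manifold; then \<open>\<kappa> v = (\<Sum>b. v(x\<^sub>b) E\<^sub>b)\<close> holds for all
  tangent vectors \<open>v\<close> (\<open>dual_frame_exists\<close>), which yields tensoriality without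
  passing to open submanifolds. That derivations are determined by their values on coordinates is
  Hadamard's lemma. Finally, smoothness of \<open>R\<close> is Cramer's rule for the matrix of brackets of the
  coordinate functions (\<open>inverse_one_form\<close>).\<close>

section \<open>Calculus of \<open>C\<^sup>k\<close> functions\<close>

lemma Ck_on_cong:
  assumes "open S" "\<And>x. x \<in> S \<Longrightarrow> f x = g x" "Ck_on k f S"
  shows "Ck_on k g S"
  using assms(2,3)
proof (induction k arbitrary: f g)
  case 0
  then show ?case by (simp cong: continuous_on_cong)
next
  case (Suc k)
  have d: "frechet_derivative f (at x) = frechet_derivative g (at x)" if "x \<in> S" for x
    by (rule frechet_derivative_transform_within_open[OF _ \<open>open S\<close> that])
      (use Suc.prems that in auto)
  have "g differentiable (at x)" if x: "x \<in> S" for x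
    using Suc.prems x \<open>open S\<close>
    by (metis Ck_on.simps(2) has_derivative_transform_within_open differentiable_def)
  moreover have "Ck_on k (\<lambda>x. frechet_derivative g (at x) v) S" for v
    by (rule Suc.IH[of "\<lambda>x. frechet_derivative f (at x) v"]) (use Suc.prems d in auto)
  ultimately show ?case by simp
qed

lemma Ck_on_subset: "Ck_on k f S \<Longrightarrow> T \<subseteq> S \<Longrightarrow> Ck_on k f T"
  by (induction k arbitrary: f) (auto intro: continuous_on_subset)

lemma Ck_on_SucD: "Ck_on (Suc k) f S \<Longrightarrow> Ck_on k f S"
  by (induction k arbitrary: f)
    (auto intro!: continuous_at_imp_continuous_on differentiable_imp_continuous_within)

lemma Ck_on_local:
  assumes "\<And>x. x \<in> S \<Longrightarrow> \<exists>T. open T \<and> x \<in> T \<and> Ck_on k f T"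
  shows "Ck_on k f S"
  using assms
proof (induction k arbitrary: f)
  case 0
  have "isCont f x" if "x \<in> S" for x
    using 0[OF that] continuous_on_eq_continuous_at by (metis Ck_on.simps(1))
  then show ?case by (simp add: continuous_at_imp_continuous_on)
next
  case (Suc k)
  have "Ck_on k (\<lambda>x. frechet_derivative f (at x) v) S" for v
    by (rule Suc.IH) (use Suc.prems in fastforce)
  then show ?case using Suc.prems by fastforce
qed

lemma Ck_on_SucI:
  assumes "open S" "\<And>x. x \<in> S \<Longrightarrow> (f has_derivative D x) (at x)"
    "\<And>v. Ck_on k (\<lambda>x. D x v) S"
  shows "Ck_on (Suc k) f S"
proof -
  have "Ck_on k (\<lambda>x. frechet_derivative f (at x) v) S" for v
    by (rule Ck_on_cong[OF assms(1) _ assms(3)]) (rule fun_cong[OF frechet_derivative_at[OF assms(2)]])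
  with assms(2) show ?thesis by (auto simp: differentiable_def)
qed

lemma Ck_on_const: "Ck_on k (\<lambda>x. c) S"
  by (induction k arbitrary: c) (auto simp: frechet_derivative_const)

lemma Ck_on_Suc_has_derivative:
  "Ck_on (Suc k) f S \<Longrightarrow> x \<in> S \<Longrightarrow> (f has_derivative frechet_derivative f (at x)) (at x)"
  by (simp add: frechet_derivative_works[symmetric])

lemma Ck_on_add:
  assumes "open S" "Ck_on k f S" "Ck_on k g S"
  shows "Ck_on k (\<lambda>x. f x + g x) S"
  using assms(2,3)
proof (induction k arbitrary: f g)
  case 0
  then show ?case by (simp add: continuous_on_add)
next
  case (Suc k)
  show ?case
    by (rule Ck_on_SucI[OF \<open>open S\<close> has_derivative_add[OF Suc.prems[THEN Ck_on_Suc_has_derivative]]])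
      (use Suc in auto)
qed

lemma Ck_on_linear:
  assumes "open S" "bounded_linear L" "Ck_on k f S"
  shows "Ck_on k (\<lambda>x. L (f x)) S"
  using assms(3)
proof (induction k arbitrary: f)
  case 0
  then show ?case by (simp add: bounded_linear.continuous_on[OF assms(2)])
next
  case (Suc k)
  show ?case
    by (rule Ck_on_SucI[OF \<open>open S\<close> 
        bounded_linear.has_derivative[OF assms(2) Ck_on_Suc_has_derivative[OF Suc.prems]]])
      (use Suc in auto)
qed

lemma Ck_on_mult:
  fixes f g :: "'a::real_normed_vector \<Rightarrow> real"
  assumes "open S" "Ck_on k f S" "Ck_on k g S"
  shows "Ck_on k (\<lambda>x. f x * g x) S"
  using assms(2,3)
proof (induction k arbitrary: f g)
  case 0
  then show ?case by (simp add: continuous_on_mult)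
next
  case (Suc k)
  show ?case
    by (rule Ck_on_SucI[OF \<open>open S\<close> has_derivative_mult[OF Suc.prems[THEN Ck_on_Suc_has_derivative]]])
      (use Suc Ck_on_SucD[OF Suc.prems(1)] Ck_on_SucD[OF Suc.prems(2)] in 
        \<open>auto intro!: Ck_on_add[OF \<open>open S\<close>]\<close>)
qed

lemma Ck_on_sum:
  assumes "open S" "finite I" "\<And>i. i \<in> I \<Longrightarrow> Ck_on k (f i) S"
  shows "Ck_on k (\<lambda>x. \<Sum>i\<in>I. f i x) S"
  using assms(2,3) by (induction I) (auto intro: Ck_on_const Ck_on_add[OF assms(1)])

lemma Ck_on_inverse:
  fixes f :: "'a::real_normed_vector \<Rightarrow> real"
  assumes "open S" "Ck_on k f S" "\<And>x. x \<in> S \<Longrightarrow> f x \<noteq> 0"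
  shows "Ck_on k (\<lambda>x. inverse (f x)) S"
  using assms(2)
proof (induction k)
  case 0
  then show ?case by (simp add: assms(3) continuous_on_inverse)
next
  case (Suc k)
  have "((\<lambda>x. inverse (f x)) has_derivative
      (\<lambda>v. (-1) * (inverse (f x) * frechet_derivative f (at x) v * inverse (f x)))) (at x)"
    if "x \<in> S" for x
    using Deriv.has_derivative_inverse[OF assms(3)[OF that] Ck_on_Suc_has_derivative[OF Suc.prems that]]
    by (simp add: fun_eq_iff)
  then show ?case
  proof (rule Ck_on_SucI[OF \<open>open S\<close>])
    show "Ck_on k (\<lambda>x. (-1) * (inverse (f x) * frechet_derivative f (at x) v * inverse (f x))) S" for v
      by (intro Ck_on_mult[OF \<open>open S\<close>] Ck_on_const Suc.IH)
        (use Suc.prems Ck_on_SucD[OF Suc.prems] in auto)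
  qed
qed

lemma Ck_on_id: "Ck_on k (\<lambda>x. x) S"
proof (cases k)
  case (Suc j)
  then show ?thesis
    using Ck_on_SucI[OF open_UNIV has_derivative_ident Ck_on_const, of j] Ck_on_subset by blast
qed (simp add: continuous_on_id)

text \<open>Expanding the inner derivative in the basis writes the derivative of \<open>g \<circ> T\<close> in a direction as a
  sum of products of functions \<open>g' b \<circ> T\<close> and coefficients of the derivative of \<open>T\<close>, to which the
  induction hypothesis applies.\<close>

lemma Ck_on_compose:
  fixes g :: "'b::euclidean_space \<Rightarrow> real" and T :: "'a::real_normed_vector \<Rightarrow> 'b"
  assumes "open S" "open V" "T ` S \<subseteq> V" "Ck_on k T S" "Ck_on k g V"
  shows "Ck_on k (\<lambda>x. g (T x)) S"
  using assms(4,5)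
proof (induction k arbitrary: g)
  case 0
  then show ?case using assms(3) by (auto intro: continuous_on_compose2)
next
  case (Suc k)
  have eq: "frechet_derivative g (at (T x)) (frechet_derivative T (at x) v) =
      (\<Sum>b\<in>Basis. (frechet_derivative T (at x) v \<bullet> b) * frechet_derivative g (at (T x)) b)"
    if "x \<in> S" for x v
  proof -
    have "linear (frechet_derivative g (at (T x)))"
      using Suc.prems(2) that assms(3) by (auto intro: linear_frechet_derivative)
    then show ?thesis
      by (subst (1) euclidean_representation[of "frechet_derivative T (at x) v", symmetric])
        (simp add: linear_sum linear_cmul)
  qed
  show ?case
  proof (rule Ck_on_SucI[OF \<open>open S\<close>, where D = "\<lambda>x v. frechet_derivative g (at (T x)) (frechet_derivative T (at x) v)"])
    fix x assume x: "x \<in> S"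
    show "((\<lambda>x. g (T x)) has_derivative (\<lambda>v. frechet_derivative g (at (T x)) (frechet_derivative T (at x) v))) (at x)"
      by (rule has_derivative_compose[OF Ck_on_Suc_has_derivative[OF Suc.prems(1) x]
          Ck_on_Suc_has_derivative[OF Suc.prems(2)]]) (use x assms(3) in auto)
  next
    fix v
    have "Ck_on k (\<lambda>x. \<Sum>b\<in>Basis. (frechet_derivative T (at x) v \<bullet> b) * frechet_derivative g (at (T x)) b) S"
      using Suc.prems Ck_on_SucD[OF Suc.prems(1)]
      by (auto intro!: Ck_on_sum[OF \<open>open S\<close>] Ck_on_mult[OF \<open>open S\<close>]
            Ck_on_linear[OF \<open>open S\<close> bounded_linear_inner_left] Suc.IH)
    then show "Ck_on k (\<lambda>x. frechet_derivative g (at (T x)) (frechet_derivative T (at x) v)) S"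
      by (rule Ck_on_cong[OF \<open>open S\<close>, rotated]) (simp add: eq)
  qed
qed

text \<open>The family \<open>x\<^sup>-\<^sup>n e\<^sup>-\<^sup>1\<^sup>/\<^sup>x\<close>, extended by zero, is closed under differentiation up to linear
  combinations; so all its members are smooth as soon as they are differentiable at zero.\<close>

definition flat :: "nat \<Rightarrow> real \<Rightarrow> real" where
  "flat n x = (if x > 0 then inverse x ^ n * exp (- inverse x) else 0)"

lemma flat_tendsto_0: "(flat n \<longlongrightarrow> 0) (at 0)"
proof (rule filterlim_split_at_real)
  show "(flat n \<longlongrightarrow> 0) (at_left 0)"
    by (rule tendsto_eventually) (auto simp: eventually_at_filter flat_def)
  have "((\<lambda>x. inverse x ^ n / exp (inverse x)) \<longlongrightarrow> 0) (at_right (0::real))"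
    by (rule filterlim_compose[OF tendsto_power_div_exp_0 filterlim_inverse_at_top_right])
  then show "(flat n \<longlongrightarrow> 0) (at_right 0)"
    by (rule Lim_transform_eventually)
      (auto simp: eventually_at_filter flat_def exp_minus field_simps)
qed

lemma flat_has_derivative:
  "(flat n has_real_derivative (flat (n + 2) x - real n * flat (n + 1) x)) (at x)"
proof -
  consider "x > 0" | "x < 0" | "x = 0" by linarith
  then show ?thesis
  proof cases
    case 1
    have "((\<lambda>x. inverse x ^ n * exp (- inverse x)) has_real_derivative
        (flat (n + 2) x - real n * flat (n + 1) x)) (at x)"
    proof -
      have u: "(inverse has_real_derivative (- (inverse x ^ 2))) (at x)"
        using DERIV_inverse[of x UNIV] 1 by (simp add: numeral_2_eq_2)
      have e: "((\<lambda>x. exp (- inverse x)) has_real_derivative exp (- inverse x) * inverse x ^ 2) (at x)"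
        using DERIV_fun_exp[OF DERIV_minus[OF u]] by simp
      have p: "((\<lambda>x. inverse x ^ n) has_real_derivative - (real n * inverse x ^ (n + 1))) (at x)"
      proof (cases n)
        case (Suc m)
        show ?thesis using DERIV_power[OF u, of n] by (simp add: Suc power2_eq_square mult_ac)
      qed simp
      show ?thesis
        by (rule DERIV_cong[OF DERIV_mult[OF p e]])
          (use 1 in \<open>simp add: flat_def power_add algebra_simps power2_eq_square\<close>)
    qed
    then show ?thesis
      by (rule has_field_derivative_transform_within_open[of _ _ _ "{0<..}"]) (use 1 in \<open>auto simp: flat_def\<close>)
  next
    case 2
    have "((\<lambda>x. 0) has_real_derivative (flat (n + 2) x - real n * flat (n + 1) x)) (at x)"
      using 2 by (simp add: flat_def)
    then show ?thesis
      by (rule has_field_derivative_transform_within_open[of _ _ _ "{..<0}"]) (use 2 in \<open>auto simp: flat_def\<close>)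
  next
    case 3
    have "((\<lambda>h. flat n h / h) \<longlongrightarrow> 0) (at 0)"
      using flat_tendsto_0[of "Suc n"]
      by (rule Lim_transform_eventually) (auto simp: eventually_at_filter flat_def field_simps)
    then show ?thesis using 3 by (simp add: DERIV_def) (simp add: flat_def)
  qed
qed

lemma Ck_on_flat: "Ck_on k (flat n) UNIV"
proof (induction k arbitrary: n)
  case 0
  show ?case
    using flat_has_derivative by (auto intro!: continuous_at_imp_continuous_on DERIV_isCont)
next
  case (Suc k)
  show ?case
  proof (rule Ck_on_SucI[OF open_UNIV])
    show "(flat n has_derivative (\<lambda>v. v * (flat (n + 2) x + (- real n) * flat (n + 1) x))) (at x)" for x
      using flat_has_derivative[of n x] by (simp add: has_field_derivative_def mult.commute[of _ "flat (Suc (Suc n)) x - _"])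
    show "Ck_on k (\<lambda>x. v * (flat (n + 2) x + (- real n) * flat (n + 1) x)) UNIV" for v
      by (intro Ck_on_mult Ck_on_add Ck_on_const open_UNIV Suc.IH)
  qed
qed

text \<open>With \<open>s = |y - c|\<^sup>2 / r\<^sup>2\<close> and \<open>h\<close> the flat function, the quotient
  \<open>h(4 - s) / (h(4 - s) + h(s - 1))\<close> equals one for \<open>s \<le> 1\<close> and zero for \<open>s \<ge> 4\<close>.\<close>

lemma plateau_exists:
  fixes c :: "'e::euclidean_space"
  assumes "r > 0"
  obtains \<rho> :: "'e \<Rightarrow> real" where "smooth_on \<rho> UNIV"
    "\<And>y. dist c y \<le> r \<Longrightarrow> \<rho> y = 1" "\<And>y. dist c y \<ge> 2 * r \<Longrightarrow> \<rho> y = 0"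
proof -
  define s where "s y = (\<Sum>b\<in>Basis. ((y - c) \<bullet> b) * ((y - c) \<bullet> b)) * inverse (r^2)" for y :: 'e
  have s: "s y = (dist c y / r)^2" for y
    by (simp add: s_def euclidean_inner[symmetric] dist_norm power2_norm_eq_inner norm_minus_commute[of c]
          power_divide divide_inverse power_mult_distrib power_inverse)
  have "Ck_on k s UNIV" for k
  proof -
    have "Ck_on k (\<lambda>y. (y - c) \<bullet> b) UNIV" for b
      by (rule Ck_on_linear[OF open_UNIV bounded_linear_inner_left])
        (use Ck_on_add[OF open_UNIV Ck_on_id Ck_on_const, of k "- c"] in simp)
    then show ?thesis
      unfolding s_def by (intro Ck_on_mult Ck_on_sum Ck_on_const open_UNIV) auto
  qed
  define h where "h = flat 0"
  define N where "N y = h (4 - s y) + h (s y - 1)" for y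
  have aff: "Ck_on k (\<lambda>y. h (a + e * s y)) UNIV" for k a e
    unfolding h_def
    by (rule Ck_on_compose[OF open_UNIV open_UNIV _ _ Ck_on_flat])
      (intro Ck_on_add Ck_on_mult Ck_on_const open_UNIV \<open>Ck_on k s UNIV\<close> subset_UNIV)+
  have N: "N y > 0" for y
    by (auto simp: N_def h_def flat_def add_pos_pos)
  define \<rho> where "\<rho> y = h (4 - s y) * inverse (N y)" for y
  have "Ck_on k (\<lambda>y. h (4 - s y)) UNIV" "Ck_on k (\<lambda>y. h (s y - 1)) UNIV" for k
    using aff[of k 4 "-1"] aff[of k "-1" 1] by simp_all
  then have "smooth_on \<rho> UNIV"
    unfolding smooth_on_def \<rho>_def N_def
    by (intro allI Ck_on_mult Ck_on_inverse Ck_on_add open_UNIV) (use N in \<open>auto simp: N_def less_le\<close>)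
  moreover have "\<rho> y = 1" if "dist c y \<le> r" for y
  proof -
    have "dist c y / r \<le> 1" using that assms by simp
    then have "s y \<le> 1" unfolding s using assms by (intro power_le_one) auto
    then have "N y = h (4 - s y)" by (auto simp: N_def h_def flat_def)
    with N[of y] show ?thesis by (simp add: \<rho>_def)
  qed
  moreover have "\<rho> y = 0" if "dist c y \<ge> 2 * r" for y
  proof -
    have "2 \<le> dist c y / r" using that assms by (simp add: field_simps)
    then have "2^2 \<le> s y" unfolding s by (intro power_mono) auto
    then show ?thesis by (simp add: \<rho>_def h_def flat_def)
  qed
  ultimately show ?thesis using that by blast
qed

section \<open>Hadamard's lemma\<close>

lemma ball_homothety:
  fixes c :: "'e::euclidean_space"
  assumes "y \<in> ball c \<epsilon>" "0 \<le> t" "t \<le> 1"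
  shows "c + t *\<^sub>R (y - c) \<in> ball c \<epsilon>"
proof -
  have "dist c (c + t *\<^sub>R (y - c)) = t * dist c y"
    using assms by (simp add: dist_norm norm_minus_commute)
  also have "\<dots> \<le> 1 * dist c y" using assms by (intro mult_right_mono) auto
  finally show ?thesis using assms by simp
qed

lemma continuous_on_homothety:
  fixes c :: "'e::euclidean_space" and f :: "'e \<Rightarrow> 'b::topological_space"
  assumes "continuous_on (ball c \<epsilon>) f"
  shows "continuous_on (ball c \<epsilon> \<times> cbox 0 1) (\<lambda>(y, t::real). f (c + t *\<^sub>R (y - c)))"
proof -
  have "continuous_on (ball c \<epsilon> \<times> cbox 0 1) (\<lambda>z. f (c + snd z *\<^sub>R (fst z - c)))"
    by (rule continuous_on_compose2[OF assms])
      (auto intro!: continuous_intros ball_homothety simp del: mem_ball)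
  then show ?thesis by (simp add: split_def)
qed

text \<open>Differentiation under the integral sign produces a factor \<open>t\<close>; the weight \<open>t\<^sup>m\<close> makes the statement
  stable under this, so that induction on \<open>k\<close> goes through.\<close>

lemma Ck_on_integral_homothety:
  fixes F :: "'e::euclidean_space \<Rightarrow> real"
  assumes "Ck_on k F (ball c \<epsilon>)"
  shows "Ck_on k (\<lambda>y. integral (cbox 0 1) (\<lambda>t. t ^ m * F (c + t *\<^sub>R (y - c)))) (ball c \<epsilon>)"
  using assms
proof (induction k arbitrary: F m)
  case 0
  have "continuous_on (ball c \<epsilon> \<times> cbox 0 1) (\<lambda>(y, t). t ^ m * F (c + t *\<^sub>R (y - c)))"
    using continuous_on_homothety[of c \<epsilon> F] 0
    by (auto simp: split_def intro!: continuous_intros)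
  then show ?case unfolding Ck_on.simps by (rule integral_continuous_on_param)
next
  case (Suc k)
  define B where "B = ball c \<epsilon>"
  define D where "D y = Blinfun (frechet_derivative F (at y))" for y
  have D: "blinfun_apply (D y) = frechet_derivative F (at y)" if "y \<in> B" for y
    unfolding D_def by (rule bounded_linear_Blinfun_apply)
      (use Ck_on_Suc_has_derivative[OF Suc.prems] that in \<open>auto simp: B_def intro: has_derivative_bounded_linear\<close>)
  define G where "G y t = t ^ Suc m *\<^sub>R D (c + t *\<^sub>R (y - c))" for y t
  have contF: "continuous_on B F"
    unfolding B_def by (rule differentiable_imp_continuous_on) (use Suc.prems in \<open>auto simp: differentiable_on_def intro: differentiable_at_withinI\<close>)
  have contD: "continuous_on B D"
  proof (rule continuous_on_blinfun_componentwise)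
    fix i :: 'e assume "i \<in> Basis"
    have "Ck_on k (\<lambda>x. frechet_derivative F (at x) i) B"
      using Suc.prems by (simp add: B_def)
    then have "continuous_on B (\<lambda>x. frechet_derivative F (at x) i)"
      by (induction k) (auto dest: Ck_on_SucD simp del: Ck_on.simps(2))
    then show "continuous_on B (\<lambda>x. D x i)" by (simp add: D cong: continuous_on_cong)
  qed
  have contG: "continuous_on (B \<times> cbox 0 1) (\<lambda>(y, t). G y t)"
    using continuous_on_homothety[OF contD[unfolded B_def]] unfolding B_def[symmetric]
    by (auto simp: G_def split_def intro!: continuous_intros)
  have sect: "continuous_on (cbox 0 1) (\<lambda>t. h y t)"
    if "continuous_on (B \<times> cbox 0 1) (\<lambda>(y, t). h y t)" "y \<in> B" for y and h :: "'e \<Rightarrow> real \<Rightarrow> 'x::topological_space"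
  proof -
    have "continuous_on (cbox 0 1) (\<lambda>t. (\<lambda>(y, t). h y t) (y, t))"
      by (rule continuous_on_compose2[OF that(1)]) (use that(2) in \<open>auto intro!: continuous_on_Pair\<close>)
    then show ?thesis by simp
  qed
  have contI: "continuous_on (B \<times> cbox 0 1) (\<lambda>(y, t). t ^ m * F (c + t *\<^sub>R (y - c)))"
    using continuous_on_homothety[OF contF[unfolded B_def]] unfolding B_def[symmetric]
    by (auto simp: split_def intro!: continuous_intros)
  have der: "((\<lambda>y. integral (cbox 0 1) (\<lambda>t. t ^ m * F (c + t *\<^sub>R (y - c)))) has_derivative
      blinfun_apply (integral (cbox 0 1) (G y))) (at y)" if y: "y \<in> B" for y
  proof -
    have "((\<lambda>y. integral (cbox 0 1) (\<lambda>t. t ^ m * F (c + t *\<^sub>R (y - c)))) has_derivative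
      blinfun_apply (integral (cbox 0 1) (G y))) (at y within B)"
    proof (rule leibniz_rule[OF _ _ contG y])
      fix y :: 'e and t :: real assume y: "y \<in> B" and t: "t \<in> cbox 0 1"
      have z: "c + t *\<^sub>R (y - c) \<in> B" using ball_homothety y t by (auto simp: B_def simp del: mem_ball)
      have "((\<lambda>y. F (c + t *\<^sub>R (y - c))) has_derivative
          (\<lambda>v. frechet_derivative F (at (c + t *\<^sub>R (y - c))) (t *\<^sub>R v))) (at y)"
        by (rule has_derivative_compose[of "\<lambda>y. c + t *\<^sub>R (y - c)"])
          (use Ck_on_Suc_has_derivative[OF Suc.prems] z in \<open>auto simp: B_def intro!: derivative_eq_intros\<close>)
      then have "((\<lambda>y. t ^ m * F (c + t *\<^sub>R (y - c))) has_derivative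
          (\<lambda>v. t ^ m * blinfun_apply (D (c + t *\<^sub>R (y - c))) (t *\<^sub>R v))) (at y)"
        unfolding D[OF z] by (rule has_derivative_mult_right)
      moreover have "(\<lambda>v. t ^ m * blinfun_apply (D (c + t *\<^sub>R (y - c))) (t *\<^sub>R v)) = blinfun_apply (G y t)"
        by (auto simp: G_def blinfun.scaleR_right blinfun.scaleR_left)
      ultimately show "((\<lambda>y. t ^ m * F (c + t *\<^sub>R (y - c))) has_derivative blinfun_apply (G y t)) (at y within B)"
        by (simp add: has_derivative_at_withinI)
    next
      fix y assume "y \<in> B"
      then show "(\<lambda>t. t ^ m * F (c + t *\<^sub>R (y - c))) integrable_on cbox 0 1"
        by (intro integrable_continuous sect[OF contI])
    qed (simp add: B_def)
    then show ?thesis by (simp only: at_within_open[OF y open_ball[of c \<epsilon>, folded B_def]])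
  qed
  have apply_G: "blinfun_apply (integral (cbox 0 1) (G y)) v =
      integral (cbox 0 1) (\<lambda>t. t ^ Suc m * frechet_derivative F (at (c + t *\<^sub>R (y - c))) v)" if y: "y \<in> B" for y v
  proof -
    have "blinfun_apply (integral (cbox 0 1) (G y)) v = integral (cbox 0 1) (\<lambda>t. blinfun_apply (G y t) v)"
      by (rule blinfun_apply_integral) (intro integrable_continuous sect[OF contG y])
    also have "\<dots> = integral (cbox 0 1) (\<lambda>t. t ^ Suc m * frechet_derivative F (at (c + t *\<^sub>R (y - c))) v)"
    proof (rule integral_cong)
      fix t :: real assume "t \<in> cbox 0 1"
      then have "c + t *\<^sub>R (y - c) \<in> B" using ball_homothety y by (auto simp: B_def simp del: mem_ball)
      then show "blinfun_apply (G y t) v = t ^ Suc m * frechet_derivative F (at (c + t *\<^sub>R (y - c))) v"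
        by (simp add: G_def blinfun.scaleR_left D)
    qed
    finally show ?thesis .
  qed
  show ?case
  proof (rule Ck_on_SucI[OF open_ball])
    fix v
    have "Ck_on k (\<lambda>y. integral (cbox 0 1) (\<lambda>t. t ^ Suc m * frechet_derivative F (at (c + t *\<^sub>R (y - c))) v)) (ball c \<epsilon>)"
      by (rule Suc.IH) (use Suc.prems in simp)
    then show "Ck_on k (\<lambda>y. blinfun_apply (integral (cbox 0 1) (G y)) v) (ball c \<epsilon>)"
      by (rule Ck_on_cong[OF open_ball, rotated]) (rule apply_G[unfolded B_def, symmetric])
  qed (use der in \<open>simp add: B_def\<close>)
qed

text \<open>Integrate the derivative of \<open>t \<mapsto> F(c + t(y - c))\<close> over the unit interval and expand \<open>y - c\<close> in the
  basis. Since \<open>G\<close> is smooth, a derivation at \<open>c\<close> applied to this formula sees only the first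
  derivatives of \<open>F\<close>.\<close>

lemma hadamard:
  fixes F :: "'e::euclidean_space \<Rightarrow> real"
  assumes "smooth_on F (ball c \<epsilon>)" "\<epsilon> > 0"
  obtains G where "\<And>b. b \<in> Basis \<Longrightarrow> smooth_on (G b) (ball c \<epsilon>)"
    "\<And>y. y \<in> ball c \<epsilon> \<Longrightarrow> F y = F c + (\<Sum>b\<in>Basis. ((y - c) \<bullet> b) * G b y)"
    "\<And>b. b \<in> Basis \<Longrightarrow> G b c = frechet_derivative F (at c) b"
proof
  define G where "G b y = integral (cbox 0 1) (\<lambda>t. t ^ 0 * frechet_derivative F (at (c + t *\<^sub>R (y - c))) b)" for b y
  have Ck: "Ck_on k F (ball c \<epsilon>)" for k using assms by (simp add: smooth_on_def)
  have CkD: "Ck_on k (\<lambda>y. frechet_derivative F (at y) b) (ball c \<epsilon>)" for k b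
    using Ck[of "Suc k"] by simp
  show "smooth_on (G b) (ball c \<epsilon>)" for b
    unfolding smooth_on_def G_def by (intro allI Ck_on_integral_homothety CkD)
  show "G b c = frechet_derivative F (at c) b" for b by (simp add: G_def)
  have dF: "(F has_derivative frechet_derivative F (at y)) (at y)" if "y \<in> ball c \<epsilon>" for y
    using Ck_on_Suc_has_derivative[OF Ck that] .
  fix y assume y: "y \<in> ball c \<epsilon>"
  have z: "c + t *\<^sub>R (y - c) \<in> ball c \<epsilon>" if "t \<in> cbox 0 1" for t
    using ball_homothety[OF y] that by auto
  have contD: "continuous_on (cbox 0 1) (\<lambda>t. frechet_derivative F (at (c + t *\<^sub>R (y - c))) b)" for b
    by (rule continuous_on_compose2[OF CkD[of 0 b, unfolded Ck_on.simps]])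
      (use z in \<open>auto intro!: continuous_intros simp del: mem_ball\<close>)
  \<comment> \<open>fundamental theorem of calculus along the segment from \<open>c\<close> to \<open>y\<close>\<close>
  have "((\<lambda>t. frechet_derivative F (at (c + t *\<^sub>R (y - c))) (y - c)) has_integral
      F (c + 1 *\<^sub>R (y - c)) - F (c + 0 *\<^sub>R (y - c))) {0..1}"
  proof (rule fundamental_theorem_of_calculus)
    fix t :: real assume t: "t \<in> {0..1}"
    have "((\<lambda>t. F (c + t *\<^sub>R (y - c))) has_derivative
        (\<lambda>s. frechet_derivative F (at (c + t *\<^sub>R (y - c))) (s *\<^sub>R (y - c)))) (at t)"
      by (rule has_derivative_compose[of "\<lambda>t. c + t *\<^sub>R (y - c)" _ _ _ F])
        (use dF z t in \<open>auto intro!: derivative_eq_intros simp del: mem_ball\<close>)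
    moreover have "linear (frechet_derivative F (at (c + t *\<^sub>R (y - c))))"
      using dF z t by (auto intro: has_derivative_linear simp del: mem_ball)
    ultimately show "((\<lambda>t. F (c + t *\<^sub>R (y - c))) has_vector_derivative
        frechet_derivative F (at (c + t *\<^sub>R (y - c))) (y - c)) (at t within {0..1})"
      by (simp add: has_vector_derivative_def linear_cmul has_derivative_at_withinI)
  qed simp
  then have "F y - F c = integral (cbox 0 1) (\<lambda>t. frechet_derivative F (at (c + t *\<^sub>R (y - c))) (y - c))"
    by (simp add: integral_unique)
  also have "\<dots> = integral (cbox 0 1) (\<lambda>t. \<Sum>b\<in>Basis. ((y - c) \<bullet> b) * frechet_derivative F (at (c + t *\<^sub>R (y - c))) b)"
  proof (rule integral_cong)
    fix t :: real assume "t \<in> cbox 0 1"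
    then have "linear (frechet_derivative F (at (c + t *\<^sub>R (y - c))))"
      using dF z by (auto intro: has_derivative_linear simp del: mem_ball)
    then show "frechet_derivative F (at (c + t *\<^sub>R (y - c))) (y - c) =
        (\<Sum>b\<in>Basis. ((y - c) \<bullet> b) * frechet_derivative F (at (c + t *\<^sub>R (y - c))) b)"
      by (subst (2) euclidean_representation[of "y - c", symmetric])
        (simp add: linear_sum linear_cmul)
  qed
  also have "\<dots> = (\<Sum>b\<in>Basis. ((y - c) \<bullet> b) * G b y)"
  proof -
    have "(\<lambda>t. ((y - c) \<bullet> b) * frechet_derivative F (at (c + t *\<^sub>R (y - c))) b) integrable_on cbox 0 1" for b
      by (intro integrable_continuous continuous_on_mult continuous_on_const contD)
    then show ?thesis unfolding G_def by (subst integral_sum) simp_all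
  qed
  finally show "F y = F c + (\<Sum>b\<in>Basis. ((y - c) \<bullet> b) * G b y)" by simp
qed

section \<open>Smooth functions, tangent vectors and local frames\<close>

lemma smooth_on_CkD: "smooth_on f S \<Longrightarrow> Ck_on k f S"
  by (simp add: smooth_on_def)

definition smooth_fun_on ::
    "('m, 'e::euclidean_space) chart set \<Rightarrow> 'm set \<Rightarrow> ('m \<Rightarrow> real) \<Rightarrow> bool" where
  "smooth_fun_on A W f \<longleftrightarrow> (\<forall>(U, \<phi>)\<in>A. smooth_on (f \<circ> inv_into U \<phi>) (\<phi> ` (U \<inter> W)))"

lemma smooth_fun_on_UNIV: "smooth_fun_on A UNIV f \<longleftrightarrow> smooth_fun A f"
  by (simp add: smooth_fun_on_def smooth_fun_def)

lemma smooth_fun_onI: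
  assumes "\<And>U \<phi> k. (U, \<phi>) \<in> A \<Longrightarrow> Ck_on k (\<lambda>y. f (inv_into U \<phi> y)) (\<phi> ` (U \<inter> W))"
  shows "smooth_fun_on A W f"
  using assms by (auto simp: smooth_fun_on_def smooth_on_def o_def)

lemma smooth_fun_onD:
  "smooth_fun_on A W f \<Longrightarrow> (U, \<phi>) \<in> A \<Longrightarrow> Ck_on k (\<lambda>y. f (inv_into U \<phi> y)) (\<phi> ` (U \<inter> W))"
  by (auto simp: smooth_fun_on_def smooth_on_def o_def)

lemma smooth_fun_on_subset: "smooth_fun_on A W f \<Longrightarrow> W' \<subseteq> W \<Longrightarrow> smooth_fun_on A W' f"
  by (rule smooth_fun_onI) (auto intro: Ck_on_subset[OF smooth_fun_onD])

lemma smooth_fun_imp_on: "smooth_fun A f \<Longrightarrow> smooth_fun_on A W f"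
  using smooth_fun_on_subset smooth_fun_on_UNIV by blast

locale smooth_mfd =
  fixes A :: "('m::{t2_space, second_countable_topology}, 'e::euclidean_space) chart set"
  assumes manifold: "smooth_manifold A"
begin

lemma chartD:
  assumes "(U, \<phi>) \<in> A"
  shows "open U" "open (\<phi> ` U)" "inj_on \<phi> U" "homeomorphism U (\<phi> ` U) \<phi> (inv_into U \<phi>)"
  using manifold assms unfolding smooth_manifold_def by blast+

lemma chart_transition:
  assumes "(U, \<phi>) \<in> A" "(V, \<psi>) \<in> A"
  shows "Ck_on k (\<lambda>y. \<psi> (inv_into U \<phi> y)) (\<phi> ` (U \<inter> V))"
  using manifold assms unfolding smooth_manifold_def smooth_on_def o_def by blast

lemma chart_exists: obtains U \<phi> where "(U, \<phi>) \<in> A" "p \<in> U"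
  using manifold unfolding smooth_manifold_def by blast

lemma chart_image_open:
  assumes "(U, \<phi>) \<in> A" "open W"
  shows "open (\<phi> ` (U \<inter> W))"
proof -
  have "openin (top_of_set (\<phi> ` U)) (\<phi> ` (U \<inter> W))"
    by (rule homeomorphism_imp_open_map[OF chartD(4)[OF assms(1)]]) (use assms in auto)
  then show ?thesis using chartD(2)[OF assms(1)] openin_open_trans by blast
qed

lemma chart_preimage_open:
  assumes "(U, \<phi>) \<in> A" "open N"
  shows "open (U \<inter> \<phi> -` N)"
  using chartD[OF assms(1)] assms(2)
  by (intro continuous_open_preimage) (auto simp: homeomorphism_def)

lemma smooth_fun_on_cong:
  assumes "open W" "\<And>q. q \<in> W \<Longrightarrow> f q = g q" "smooth_fun_on A W f"
  shows "smooth_fun_on A W g"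
proof (rule smooth_fun_onI)
  fix U \<phi> k assume c: "(U, \<phi>) \<in> A"
  show "Ck_on k (\<lambda>y. g (inv_into U \<phi> y)) (\<phi> ` (U \<inter> W))"
    by (rule Ck_on_cong[OF chart_image_open[OF c assms(1)] _ smooth_fun_onD[OF assms(3) c]])
      (use chartD(3)[OF c] assms(2) in auto)
qed

lemma smooth_fun_on_local:
  assumes "\<And>p. p \<in> W \<Longrightarrow> \<exists>N. open N \<and> p \<in> N \<and> smooth_fun_on A N f"
  shows "smooth_fun_on A W f"
proof (rule smooth_fun_onI, rule Ck_on_local)
  fix U \<phi> k x assume c: "(U, \<phi>) \<in> A" and "x \<in> \<phi> ` (U \<inter> W)"
  then obtain p where p: "p \<in> U" "p \<in> W" "x = \<phi> p" by auto
  obtain N where "open N" "p \<in> N" "smooth_fun_on A N f" using assms[OF p(2)] by blast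
  then show "\<exists>T. open T \<and> x \<in> T \<and> Ck_on k (\<lambda>y. f (inv_into U \<phi> y)) T"
    using p c by (intro exI[of _ "\<phi> ` (U \<inter> N)"]) (auto intro: chart_image_open smooth_fun_onD)
qed

lemma smooth_fun_local:
  assumes "\<And>p. \<exists>N. open N \<and> p \<in> N \<and> smooth_fun_on A N f"
  shows "smooth_fun A f"
  using smooth_fun_on_local[of UNIV f] assms by (simp add: smooth_fun_on_UNIV)

lemma smooth_fun_on_const: "smooth_fun_on A W (\<lambda>q. c)"
  by (rule smooth_fun_onI) (rule Ck_on_const)

lemma smooth_fun_on_add:
  "open W \<Longrightarrow> smooth_fun_on A W f \<Longrightarrow> smooth_fun_on A W g \<Longrightarrow> smooth_fun_on A W (\<lambda>q. f q + g q)"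
  by (rule smooth_fun_onI) (intro Ck_on_add chart_image_open smooth_fun_onD)

lemma smooth_fun_on_mult:
  "open W \<Longrightarrow> smooth_fun_on A W f \<Longrightarrow> smooth_fun_on A W g \<Longrightarrow> smooth_fun_on A W (\<lambda>q. f q * g q)"
  by (rule smooth_fun_onI) (intro Ck_on_mult chart_image_open smooth_fun_onD)

lemma smooth_fun_on_sum:
  assumes "open W" "finite I" "\<And>i. i \<in> I \<Longrightarrow> smooth_fun_on A W (f i)"
  shows "smooth_fun_on A W (\<lambda>q. \<Sum>i\<in>I. f i q)"
  using assms(2,3) by (induction I) (auto intro: smooth_fun_on_const smooth_fun_on_add[OF assms(1)])

lemma smooth_fun_on_prod:
  assumes "open W" "finite I" "\<And>i. i \<in> I \<Longrightarrow> smooth_fun_on A W (f i)"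
  shows "smooth_fun_on A W (\<lambda>q. \<Prod>i\<in>I. f i q)"
  using assms(2,3) by (induction I) (auto intro: smooth_fun_on_const smooth_fun_on_mult[OF assms(1)])

lemma smooth_fun_on_inverse:
  assumes "open W" "smooth_fun_on A W f" "\<And>q. q \<in> W \<Longrightarrow> f q \<noteq> 0"
  shows "smooth_fun_on A W (\<lambda>q. inverse (f q))"
proof (rule smooth_fun_onI)
  fix U \<phi> k assume c: "(U, \<phi>) \<in> A"
  show "Ck_on k (\<lambda>y. inverse (f (inv_into U \<phi> y))) (\<phi> ` (U \<inter> W))"
    by (rule Ck_on_inverse[OF chart_image_open[OF c assms(1)] smooth_fun_onD[OF assms(2) c]])
      (use chartD(3)[OF c] assms(3) in auto)
qed

lemma smooth_fun_const: "smooth_fun A (\<lambda>q. c)"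
  using smooth_fun_on_const[of UNIV] by (simp add: smooth_fun_on_UNIV)

lemma smooth_fun_add: "smooth_fun A f \<Longrightarrow> smooth_fun A g \<Longrightarrow> smooth_fun A (\<lambda>q. f q + g q)"
  using smooth_fun_on_add[OF open_UNIV] by (simp add: smooth_fun_on_UNIV)

lemma smooth_fun_mult: "smooth_fun A f \<Longrightarrow> smooth_fun A g \<Longrightarrow> smooth_fun A (\<lambda>q. f q * g q)"
  using smooth_fun_on_mult[OF open_UNIV] by (simp add: smooth_fun_on_UNIV)

lemma smooth_fun_uminus: "smooth_fun A f \<Longrightarrow> smooth_fun A (\<lambda>q. - f q)"
  using smooth_fun_mult[OF smooth_fun_const, of f "-1"] by simp

lemma smooth_fun_diff: "smooth_fun A f \<Longrightarrow> smooth_fun A g \<Longrightarrow> smooth_fun A (\<lambda>q. f q - g q)"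
  using smooth_fun_add[OF _ smooth_fun_uminus] by fastforce

lemmas smooth_fun_sum = smooth_fun_on_sum[OF open_UNIV, unfolded smooth_fun_on_UNIV]

text \<open>A function on the coordinate ball of radius \<open>r\<close> around \<open>c\<close>, damped by \<open>\<rho>\<close>, as a function on
  the manifold.\<close>

definition cutoff :: "'m set \<Rightarrow> ('m \<Rightarrow> 'e) \<Rightarrow> 'e \<Rightarrow> real \<Rightarrow> ('e \<Rightarrow> real) \<Rightarrow> ('e \<Rightarrow> real) \<Rightarrow> 'm \<Rightarrow> real" where
  "cutoff U \<phi> c r \<rho> g q = (if q \<in> U \<and> dist c (\<phi> q) < r then \<rho> (\<phi> q) * g (\<phi> q) else 0)"

text \<open>The preimage of the closed ball of radius \<open>s\<close> is compact, hence closed by the Hausdorff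
  property, so its complement and the chart domain form an open cover on whose members smoothness is
  clear.\<close>

lemma smooth_cutoff:
  assumes c: "(U, \<phi>) \<in> A" and B: "ball c r \<subseteq> \<phi> ` U" and "s < r"
    and \<rho>: "smooth_on \<rho> UNIV" "\<And>y. dist c y \<ge> s \<Longrightarrow> \<rho> y = 0" and g: "smooth_on g (ball c r)"
  shows "smooth_fun A (cutoff U \<phi> c r \<rho> g)"
proof (rule smooth_fun_local)
  fix p
  define K where "K = inv_into U \<phi> ` cball c s"
  have cb: "cball c s \<subseteq> ball c r" using \<open>s < r\<close> by auto
  have "continuous_on (cball c s) (inv_into U \<phi>)"
    using chartD(4)[OF c] cb B by (auto simp: homeomorphism_def intro: continuous_on_subset)
  then have "closed K"
    unfolding K_def by (intro compact_imp_closed compact_continuous_image compact_cball)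
  have KU: "p \<in> U \<inter> \<phi> -` ball c r" if "p \<in> K"
    using that cb B unfolding K_def by (force simp: f_inv_into_f inv_into_into)
  have out: "cutoff U \<phi> c r \<rho> g q = 0" if "q \<notin> K" for q
  proof (cases "q \<in> U")
    case True
    have "dist c (\<phi> q) > s"
      using that True chartD(3)[OF c] unfolding K_def
      by (metis image_eqI inv_into_f_f mem_cball not_le_imp_less)
    then show ?thesis using \<rho>(2) by (simp add: cutoff_def)
  qed (simp add: cutoff_def)
  have inner: "smooth_fun_on A (U \<inter> \<phi> -` ball c r) (cutoff U \<phi> c r \<rho> g)"
  proof (rule smooth_fun_on_cong)
    show o: "open (U \<inter> \<phi> -` ball c r)" using chart_preimage_open[OF c] by simp
    show "smooth_fun_on A (U \<inter> \<phi> -` ball c r) (\<lambda>q. \<rho> (\<phi> q) * g (\<phi> q))"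
    proof (rule smooth_fun_on_mult[OF o])
      have comp: "smooth_fun_on A (U \<inter> \<phi> -` ball c r) (\<lambda>q. h (\<phi> q))" if "smooth_on h (ball c r)" for h
      proof (rule smooth_fun_onI)
        fix V \<psi> k assume V: "(V, \<psi>) \<in> A"
        show "Ck_on k (\<lambda>y. h (\<phi> (inv_into V \<psi> y))) (\<psi> ` (V \<inter> (U \<inter> \<phi> -` ball c r)))"
          by (rule Ck_on_compose[OF chart_image_open[OF V o] open_ball _
              Ck_on_subset[OF chart_transition[OF V c]] smooth_on_CkD[OF that]])
            (use chartD(3)[OF V] in auto)
      qed
      show "smooth_fun_on A (U \<inter> \<phi> -` ball c r) (\<lambda>q. \<rho> (\<phi> q))"
        by (rule comp) (use \<rho>(1) in \<open>auto simp: smooth_on_def intro: Ck_on_subset\<close>)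
      show "smooth_fun_on A (U \<inter> \<phi> -` ball c r) (\<lambda>q. g (\<phi> q))"
        by (rule comp) (rule g)
    qed
  qed (simp add: cutoff_def)
  have outer: "smooth_fun_on A (- K) (cutoff U \<phi> c r \<rho> g)"
    by (rule smooth_fun_on_cong[OF _ _ smooth_fun_on_const[of _ 0]]) (use \<open>closed K\<close> out in auto)
  show "\<exists>N. open N \<and> p \<in> N \<and> smooth_fun_on A N (cutoff U \<phi> c r \<rho> g)"
  proof (cases "p \<in> K")
    case True
    show ?thesis
      by (intro exI[of _ "U \<inter> \<phi> -` ball c r"] conjI inner KU[OF True] chart_preimage_open[OF c] open_ball)
  next
    case False
    then show ?thesis using \<open>closed K\<close> outer by (intro exI[of _ "- K"]) auto
  qed
qed

lemma bump_exists:
  assumes "open N" "p \<in> N"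
  obtains \<beta> where "smooth_fun A \<beta>" "\<beta> p = 1" "\<And>q. q \<notin> N \<Longrightarrow> \<beta> q = 0"
proof -
  obtain U \<phi> where c: "(U, \<phi>) \<in> A" "p \<in> U" by (rule chart_exists)
  have "open (\<phi> ` (U \<inter> N))" "\<phi> p \<in> \<phi> ` (U \<inter> N)"
    using chart_image_open c assms by auto
  then obtain r where r: "r > 0" "ball (\<phi> p) r \<subseteq> \<phi> ` (U \<inter> N)"
    using openE by blast
  obtain \<rho> :: "'e \<Rightarrow> real" where \<rho>: "smooth_on \<rho> UNIV" "\<And>y. dist (\<phi> p) y \<le> r/3 \<Longrightarrow> \<rho> y = 1"
    "\<And>y. dist (\<phi> p) y \<ge> 2 * (r/3) \<Longrightarrow> \<rho> y = 0"
    using r by (rule_tac plateau_exists[of "r/3" "\<phi> p"]) auto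
  show ?thesis
  proof
    show "smooth_fun A (cutoff U \<phi> (\<phi> p) r \<rho> (\<lambda>_. 1))"
      by (rule smooth_cutoff[OF c(1) _ _ \<rho>(1), where s = "2 * (r/3)"]) (use r \<rho>(3) in \<open>auto simp: smooth_on_def Ck_on_const\<close>)
    show "cutoff U \<phi> (\<phi> p) r \<rho> (\<lambda>_. 1) p = 1" using c r \<rho>(2) by (simp add: cutoff_def)
    fix q assume "q \<notin> N"
    then have "\<not> (q \<in> U \<and> dist (\<phi> p) (\<phi> q) < r)"
      using r(2) chartD(3)[OF c(1)] by (auto simp: subset_iff inj_on_def)
    then show "cutoff U \<phi> (\<phi> p) r \<rho> (\<lambda>_. 1) q = 0" by (auto simp: cutoff_def)
  qed
qed

lemma
  assumes "v \<in> tangent_space A p" "smooth_fun A f" "smooth_fun A g"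
  shows tangent_lincomb: "v (\<lambda>q. a * f q + b * g q) = a * v f + b * v g"
    and tangent_add: "v (\<lambda>q. f q + g q) = v f + v g"
    and tangent_mult: "v (\<lambda>q. f q * g q) = f p * v g + g p * v f"
proof -
  have lin: "v (a *\<^sub>R f + b *\<^sub>R g) = a *\<^sub>R v f + b *\<^sub>R v g" for a b
    using assms unfolding tangent_space_def linear_on_subspace_def by blast
  show "v (\<lambda>q. a * f q + b * g q) = a * v f + b * v g"
    using lin[of a b] by (simp add: plus_fun_def scaleR_fun_def)
  show "v (\<lambda>q. f q + g q) = v f + v g"
    using lin[of 1 1] by (simp add: plus_fun_def)
  show "v (\<lambda>q. f q * g q) = f p * v g + g p * v f"
    using assms unfolding tangent_space_def by blast
qed

lemma tangent_cmul:
  assumes "v \<in> tangent_space A p" "smooth_fun A f"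
  shows "v (\<lambda>q. c * f q) = c * v f"
  using tangent_lincomb[OF assms assms(2), of c 0] by simp

lemma tangent_nonsmooth: "v \<in> tangent_space A p \<Longrightarrow> \<not> smooth_fun A f \<Longrightarrow> v f = 0"
  by (simp add: tangent_space_def)

lemma tangent_const: 
  assumes "v \<in> tangent_space A p"
  shows "v (\<lambda>q. c) = 0"
proof -
  \<comment> \<open>the Leibniz rule for \<open>1 = 1 * 1\<close> gives \<open>v 1 = 2 * v 1\<close>\<close>
  have "v (\<lambda>q. 1 * 1) = 1 * v (\<lambda>q. 1) + 1 * v (\<lambda>q. 1)"
    by (rule tangent_mult[OF assms]) (rule smooth_fun_const)+
  then show ?thesis using tangent_cmul[OF assms smooth_fun_const, of c 1] by simp
qed

lemma tangent_diff:
  assumes "v \<in> tangent_space A p" "smooth_fun A f" "smooth_fun A g"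
  shows "v (\<lambda>q. f q - g q) = v f - v g"
  using tangent_add[OF assms(1,2) smooth_fun_mult[OF smooth_fun_const assms(3)], of "-1"]
    tangent_cmul[OF assms(1,3), of "-1"] by simp

lemma tangent_sum:
  assumes "v \<in> tangent_space A p" "finite I" "\<And>i. i \<in> I \<Longrightarrow> smooth_fun A (f i)"
  shows "v (\<lambda>q. \<Sum>i\<in>I. f i q) = (\<Sum>i\<in>I. v (f i))"
  using assms(2,3)
proof (induction I)
  case (insert i I)
  then show ?case
    using tangent_add[OF assms(1) _ smooth_fun_sum[of I f], of "f i"] by simp
qed (simp add: tangent_const[OF assms(1)])

lemma tangent_spaceI:
  assumes "\<And>f g a b. smooth_fun A f \<Longrightarrow> smooth_fun A g \<Longrightarrow> v (\<lambda>q. a * f q + b * g q) = a * v f + b * v g"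
    "\<And>f g. smooth_fun A f \<Longrightarrow> smooth_fun A g \<Longrightarrow> v (\<lambda>q. f q * g q) = f p * v g + g p * v f"
    "\<And>f. \<not> smooth_fun A f \<Longrightarrow> v f = 0"
  shows "v \<in> tangent_space A p"
  using assms by (auto simp: tangent_space_def linear_on_subspace_def plus_fun_def scaleR_fun_def)

lemma smooth_fun_lincomb:
  "smooth_fun A f \<Longrightarrow> smooth_fun A g \<Longrightarrow> smooth_fun A (\<lambda>q. a * f q + b * g q)"
  by (intro smooth_fun_add smooth_fun_mult smooth_fun_const)

lemma tangent_space_lincomb:
  assumes "v \<in> tangent_space A p" "w \<in> tangent_space A p"
  shows "a *\<^sub>R v + b *\<^sub>R w \<in> tangent_space A p"
  by (rule tangent_spaceI)
    (use assms in \<open>simp_all add: plus_fun_def scaleR_fun_def tangent_lincomb tangent_mult tangent_nonsmooth algebra_simps\<close>)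

lemma tangent_space_0: "0 \<in> tangent_space A p"
  by (rule tangent_spaceI) simp_all

lemma tangent_space_scaleR: "v \<in> tangent_space A p \<Longrightarrow> a *\<^sub>R v \<in> tangent_space A p"
  using tangent_space_lincomb[of v p v a 0] by simp

text \<open>The product of \<open>f - g\<close> with a bump function supported in \<open>N\<close> is zero, and the Leibniz rule
  recovers \<open>v(f - g)\<close> from it.\<close>

lemma tangent_local:
  assumes v: "v \<in> tangent_space A p" and f: "smooth_fun A f" and g: "smooth_fun A g"
    and "open N" "p \<in> N" and eq: "\<And>q. q \<in> N \<Longrightarrow> f q = g q"
  shows "v f = v g"
proof -
  obtain \<beta> where \<beta>: "smooth_fun A \<beta>" "\<beta> p = 1" "\<And>q. q \<notin> N \<Longrightarrow> \<beta> q = 0"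
    using bump_exists[OF \<open>open N\<close> \<open>p \<in> N\<close>] by metis
  have "(\<lambda>q. \<beta> q * (f q - g q)) = (\<lambda>q. 0)"
    using eq \<beta>(3) by fastforce
  then have "0 = v (\<lambda>q. \<beta> q * (f q - g q))" using tangent_const[OF v, of 0] by simp
  also have "\<dots> = v f - v g"
    using tangent_mult[OF v \<beta>(1) smooth_fun_diff[OF f g]] tangent_diff[OF v f g] \<beta>(2) eq[OF \<open>p \<in> N\<close>] by simp
  finally show ?thesis by simp
qed

definition chart_partial :: "'m set \<Rightarrow> ('m \<Rightarrow> 'e) \<Rightarrow> 'e \<Rightarrow> 'm vfield" where
  "chart_partial U \<phi> b q = (\<lambda>f. if smooth_fun A f
     then frechet_derivative (\<lambda>y. f (inv_into U \<phi> y)) (at (\<phi> q)) b else 0)"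

lemma smooth_fun_chart_Ck:
  assumes "smooth_fun A f" "(U, \<phi>) \<in> A"
  shows "Ck_on k (\<lambda>y. f (inv_into U \<phi> y)) (\<phi> ` U)"
  using smooth_fun_onD[of A UNIV f] assms by (simp add: smooth_fun_on_UNIV)

lemma chart_partial_tangent:
  assumes c: "(U, \<phi>) \<in> A" and q: "q \<in> U"
  shows "chart_partial U \<phi> b q \<in> tangent_space A q"
proof (rule tangent_spaceI)
  fix f g assume f: "smooth_fun A f" and g: "smooth_fun A g"
  have D: "((\<lambda>y. h (inv_into U \<phi> y)) has_derivative
      frechet_derivative (\<lambda>y. h (inv_into U \<phi> y)) (at (\<phi> q))) (at (\<phi> q))" if "smooth_fun A h" for h
    using Ck_on_Suc_has_derivative[OF smooth_fun_chart_Ck[OF that c]] q by blast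
  have inv: "inv_into U \<phi> (\<phi> q) = q" using chartD(3)[OF c] q by simp
  show "chart_partial U \<phi> b q (\<lambda>q. x * f q + y * g q) =
      x * chart_partial U \<phi> b q f + y * chart_partial U \<phi> b q g" for x y
    using frechet_derivative_at[OF has_derivative_add[OF has_derivative_mult_right[OF D[OF f], of x]
        has_derivative_mult_right[OF D[OF g], of y]], symmetric]
    by (simp add: chart_partial_def f g smooth_fun_lincomb)
  show "chart_partial U \<phi> b q (\<lambda>q. f q * g q) = f q * chart_partial U \<phi> b q g + g q * chart_partial U \<phi> b q f"
    using frechet_derivative_at[OF has_derivative_mult[OF D[OF f] D[OF g]], symmetric]
    by (simp add: chart_partial_def f g smooth_fun_mult inv)
qed (simp add: chart_partial_def)

text \<open>Coordinates \<open>x\<close> and coordinate fields \<open>E\<close> extended to the whole manifold: on the open set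
  where the cut-off \<open>\<kappa>\<close> does not vanish, the fields \<open>E b / \<kappa>\<close> are the basis dual to the differentials of
  the \<open>x b\<close>.\<close>

definition dual_frame :: "('e \<Rightarrow> 'm \<Rightarrow> real) \<Rightarrow> ('e \<Rightarrow> 'm vfield) \<Rightarrow> ('m \<Rightarrow> real) \<Rightarrow> bool" where
  "dual_frame x E \<kappa> \<longleftrightarrow>
    (\<forall>b\<in>Basis. smooth_fun A (x b)) \<and> (\<forall>b\<in>Basis. vector_field A (E b)) \<and> smooth_fun A \<kappa> \<and>
    (\<forall>b\<in>Basis. \<forall>b'\<in>Basis. \<forall>q. E b q (x b') = (if b = b' then \<kappa> q else 0)) \<and>
    (\<forall>q. \<forall>v\<in>tangent_space A q. \<forall>f. smooth_fun A f \<longrightarrow> \<kappa> q * v f = (\<Sum>b\<in>Basis. v (x b) * E b q f))"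

text \<open>Two plateau functions are used: \<open>\<rho>\<close> cuts off the coordinate fields, and \<open>\<rho>'\<close>, which equals one on the
  support of \<open>\<rho>\<close>, cuts off the coordinates, so that the latter are genuine coordinates wherever
  \<open>\<kappa>\<close> does not vanish. The expansion of a derivation follows from Hadamard's lemma.\<close>

lemma dual_frame_exists: "\<exists>x E \<kappa>. dual_frame x E \<kappa> \<and> \<kappa> p = 1"
proof -
  obtain U \<phi> where c: "(U, \<phi>) \<in> A" "p \<in> U" by (rule chart_exists)
  define y0 where "y0 = \<phi> p"
  have inv: "inv_into U \<phi> (\<phi> q) = q" if "q \<in> U" for q using chartD(3)[OF c(1)] that by simp
  obtain R where R: "R > 0" "ball y0 R \<subseteq> \<phi> ` U"
    using openE[OF chartD(2)[OF c(1)], of y0] c(2) by (auto simp: y0_def)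
  \<comment> \<open>\<open>\<rho>'\<close> vanishes outside the ball of radius \<open>4 * r\<close>, which has to be smaller than \<open>R\<close>\<close>
  define r where "r = R / 5"
  have r: "r > 0" "2 * r < R" "2 * (2 * r) < R" using R by (auto simp: r_def)
  obtain \<rho> :: "'e \<Rightarrow> real" where \<rho>: "smooth_on \<rho> UNIV" "\<And>y. dist y0 y \<le> r \<Longrightarrow> \<rho> y = 1"
    "\<And>y. dist y0 y \<ge> 2 * r \<Longrightarrow> \<rho> y = 0"
    by (fact plateau_exists[OF r(1), of y0])
  obtain \<rho>' :: "'e \<Rightarrow> real" where \<rho>': "smooth_on \<rho>' UNIV" "\<And>y. dist y0 y \<le> 2 * r \<Longrightarrow> \<rho>' y = 1"
    "\<And>y. dist y0 y \<ge> 2 * (2 * r) \<Longrightarrow> \<rho>' y = 0"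
    using r(1) by (rule_tac plateau_exists[of "2 * r" y0]) auto
  define \<kappa> where "\<kappa> = cutoff U \<phi> y0 R \<rho> (\<lambda>_. 1)"
  define x where "x b = cutoff U \<phi> y0 R \<rho>' (\<lambda>y. y \<bullet> b)" for b
  define E where "E b q = (if q \<in> U then \<kappa> q *\<^sub>R chart_partial U \<phi> b q else 0)" for b q
  have \<kappa>_nz: "q \<in> U \<and> dist y0 (\<phi> q) < 2 * r" if "\<kappa> q \<noteq> 0" for q
    using that \<rho>(3)[of "\<phi> q"] by (force simp: \<kappa>_def cutoff_def split: if_splits)
  have sm_\<kappa>: "smooth_fun A \<kappa>"
    unfolding \<kappa>_def by (rule smooth_cutoff[OF c(1) R(2) r(2) \<rho>(1,3)]) (auto simp: smooth_on_def Ck_on_const)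
  have sm_x: "smooth_fun A (x b)" for b
    unfolding x_def by (rule smooth_cutoff[OF c(1) R(2) r(3) \<rho>'(1,3)])
      (auto simp: smooth_on_def intro: Ck_on_linear[OF open_ball bounded_linear_inner_left Ck_on_id])
  have x_eq: "x b q = \<phi> q \<bullet> b" if "q \<in> U" "dist y0 (\<phi> q) < 2 * r" for b q
    using that r \<rho>'(2)[of "\<phi> q"] by (simp add: x_def cutoff_def)
  have E_apply: "E b q f = \<kappa> q * frechet_derivative (\<lambda>y. f (inv_into U \<phi> y)) (at (\<phi> q)) b"
    if "smooth_fun A f" for b q f
    using that \<kappa>_nz[of q] by (auto simp: E_def scaleR_fun_def chart_partial_def)
  have vf_E: "vector_field A (E b)" for b
    unfolding vector_field_def
  proof (intro conjI allI impI)
    show "E b q \<in> tangent_space A q" for q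
      by (simp add: E_def tangent_space_0 tangent_space_scaleR chart_partial_tangent[OF c(1)])
    fix f assume f: "smooth_fun A f"
    have "(\<lambda>q. E b q f) = cutoff U \<phi> y0 R \<rho> (\<lambda>y. frechet_derivative (\<lambda>y. f (inv_into U \<phi> y)) (at y) b)"
      by (rule ext) (auto simp: E_apply[OF f] \<kappa>_def cutoff_def)
    moreover have "smooth_fun A \<dots>"
    proof (rule smooth_cutoff[OF c(1) R(2) r(2) \<rho>(1,3)])
      show "smooth_on (\<lambda>y. frechet_derivative (\<lambda>y. f (inv_into U \<phi> y)) (at y) b) (ball y0 R)"
        unfolding smooth_on_def
      proof
        fix k
        show "Ck_on k (\<lambda>y. frechet_derivative (\<lambda>y. f (inv_into U \<phi> y)) (at y) b) (ball y0 R)"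
          using Ck_on_subset[OF smooth_fun_chart_Ck[OF f c(1), of "Suc k"] R(2)] by simp
      qed
    qed
    ultimately show "smooth_fun A (\<lambda>q. E b q f)" by simp
  qed
  have dual: "E b q (x b') = (if b = b' then \<kappa> q else 0)" if b: "b \<in> Basis" "b' \<in> Basis" for b b' q
  proof (cases "\<kappa> q = 0")
    case False
    then have q: "q \<in> U" "dist y0 (\<phi> q) < 2 * r" using \<kappa>_nz by auto
    have "((\<lambda>y. x b' (inv_into U \<phi> y)) has_derivative (\<lambda>v. v \<bullet> b')) (at (\<phi> q))"
    proof (rule has_derivative_transform_within_open[of "\<lambda>y. y \<bullet> b'" _ _ _ "ball y0 (2 * r)"])
      fix y assume y: "y \<in> ball y0 (2 * r)"
      then have "y \<in> \<phi> ` U" using R(2) r by auto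
      then show "y \<bullet> b' = x b' (inv_into U \<phi> y)"
        using y by (auto simp: inv x_eq)
    qed (use q in \<open>auto intro!: derivative_eq_intros\<close>)
    from frechet_derivative_at[OF this, symmetric] show ?thesis
      using b by (simp add: E_apply[OF sm_x] inner_Basis)
  qed (simp add: E_apply[OF sm_x])
  have expand: "\<kappa> q * v f = (\<Sum>b\<in>Basis. v (x b) * E b q f)"
    if v: "v \<in> tangent_space A q" and f: "smooth_fun A f" for v q f
  proof (cases "\<kappa> q = 0")
    case False
    then have q: "q \<in> U" "dist y0 (\<phi> q) < 2 * r" using \<kappa>_nz by auto
    define y1 where "y1 = \<phi> q"
    have "y1 \<in> ball y0 (2 * r)" using q by (simp add: y1_def)
    then obtain \<epsilon> where \<epsilon>: "\<epsilon> > 0" "ball y1 \<epsilon> \<subseteq> ball y0 (2 * r)" using openE[OF open_ball] by blast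
    have sub: "ball y1 \<epsilon> \<subseteq> \<phi> ` U" using \<epsilon>(2) R(2) r by force
    define F where "F = (\<lambda>y. f (inv_into U \<phi> y))"
    have smF: "smooth_on F (ball y1 \<epsilon>)"
      unfolding smooth_on_def F_def using Ck_on_subset[OF smooth_fun_chart_Ck[OF f c(1)] sub] by blast
    obtain G where G: "\<And>b. b \<in> Basis \<Longrightarrow> smooth_on (G b) (ball y1 \<epsilon>)"
      "\<And>y. y \<in> ball y1 \<epsilon> \<Longrightarrow> F y = F y1 + (\<Sum>b\<in>Basis. ((y - y1) \<bullet> b) * G b y)"
      "\<And>b. b \<in> Basis \<Longrightarrow> G b y1 = frechet_derivative F (at y1) b"
      by (fact hadamard[OF smF \<epsilon>(1)])
    obtain \<sigma> :: "'e \<Rightarrow> real" where \<sigma>: "smooth_on \<sigma> UNIV" "\<And>y. dist y1 y \<le> \<epsilon>/3 \<Longrightarrow> \<sigma> y = 1"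
      "\<And>y. dist y1 y \<ge> 2 * (\<epsilon>/3) \<Longrightarrow> \<sigma> y = 0"
      using \<epsilon> by (rule_tac plateau_exists[of "\<epsilon>/3" y1]) auto
    define g where "g b = cutoff U \<phi> y1 \<epsilon> \<sigma> (G b)" for b
    have sm_g: "smooth_fun A (g b)" if "b \<in> Basis" for b
      unfolding g_def by (rule smooth_cutoff[OF c(1) sub _ \<sigma>(1) _ G(1)[OF that], where s = "2 * (\<epsilon>/3)"]) (use \<epsilon> \<sigma>(3) in auto)
    define h where "h b q' = x b q' + (- (y1 \<bullet> b))" for b q'
    have sm_h: "smooth_fun A (h b)" for b
      unfolding h_def by (intro smooth_fun_add sm_x smooth_fun_const)
    have sm_hg: "smooth_fun A (\<lambda>q'. h b q' * g b q')" if "b \<in> Basis" for b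
      using sm_h sm_g[OF that] by (rule smooth_fun_mult)
    have gq: "g b q = G b y1" for b
      using q(1) \<epsilon>(1) \<sigma>(2)[of y1] by (simp add: g_def cutoff_def y1_def)
    have hq: "h b q = 0" for b
      using x_eq[OF q] by (simp add: h_def y1_def)
    \<comment> \<open>Hadamard's formula holds near \<open>q\<close>, with globally smooth functions in it\<close>
    have "v f = v (\<lambda>q'. f q + (\<Sum>b\<in>Basis. h b q' * g b q'))"
    proof (rule tangent_local[OF v f, of _ "U \<inter> \<phi> -` ball y1 (\<epsilon>/3)"])
      show "smooth_fun A (\<lambda>q'. f q + (\<Sum>b\<in>Basis. h b q' * g b q'))"
        by (intro smooth_fun_add smooth_fun_const smooth_fun_sum sm_hg) auto
      fix q' assume q': "q' \<in> U \<inter> \<phi> -` ball y1 (\<epsilon>/3)"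
      then have d: "dist y1 (\<phi> q') < \<epsilon>/3" "\<phi> q' \<in> ball y1 \<epsilon>" using \<epsilon>(1) by auto
      then have "dist y0 (\<phi> q') < 2 * r" using \<epsilon>(2) by auto
      then have "h b q' * g b q' = ((\<phi> q' - y1) \<bullet> b) * G b (\<phi> q')" for b
        using q' d \<sigma>(2)[of "\<phi> q'"] by (simp add: h_def x_eq g_def cutoff_def inner_diff_left)
      then show "f q' = f q + (\<Sum>b\<in>Basis. h b q' * g b q')"
        using G(2)[OF d(2)] q' q(1) by (simp add: F_def inv y1_def)
    qed (use chart_preimage_open[OF c(1) open_ball] q(1) \<epsilon>(1) in \<open>auto simp: y1_def\<close>)
    also have "\<dots> = (\<Sum>b\<in>Basis. v (\<lambda>q'. h b q' * g b q'))"
      using tangent_add[OF v smooth_fun_const smooth_fun_sum[OF finite_Basis, of "\<lambda>b q'. h b q' * g b q'", OF sm_hg]]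
        tangent_sum[OF v finite_Basis, of "\<lambda>b q'. h b q' * g b q'", OF sm_hg] tangent_const[OF v] by simp
    also have "\<dots> = (\<Sum>b\<in>Basis. v (x b) * G b y1)"
    proof (rule sum.cong)
      fix b :: 'e assume b: "b \<in> Basis"
      have "v (h b) = v (x b)"
        unfolding h_def using tangent_diff[OF v sm_x smooth_fun_const] tangent_const[OF v] by simp
      then show "v (\<lambda>q'. h b q' * g b q') = v (x b) * G b y1"
        using tangent_mult[OF v sm_h sm_g[OF b]] by (simp add: hq gq)
    qed simp
    finally show ?thesis
      by (simp add: E_apply[OF f] G(3)[unfolded y1_def F_def] y1_def sum_distrib_left mult_ac cong: sum.cong)
  qed (simp add: E_apply[OF f])
  have "\<kappa> p = 1"
    using c(2) R(1) r \<rho>(2)[of y0] by (simp add: \<kappa>_def cutoff_def y0_def)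
  moreover have "dual_frame x E \<kappa>"
    unfolding dual_frame_def using sm_x vf_E sm_\<kappa> dual expand by blast
  ultimately show ?thesis by blast
qed

end

section \<open>Vector fields, tensors and tensoriality\<close>

text \<open>Tangent vectors are functions; sums of them are from now on treated as sums in an abelian group and not
  evaluated pointwise. The group identities below are stated for an arbitrary group for the same reason.\<close>

declare plus_fun_apply [simp del]

lemma sum_fun_apply: "(\<Sum>i\<in>I. f i) x = (\<Sum>i\<in>I. f i x)"
  by (induction I rule: infinite_finite_induct) (auto simp: plus_fun_apply)

lemma group_cancel_middle:
  fixes a b d r w :: "'a::ab_group_add"
  shows "r' = r + b - w \<Longrightarrow> a + r' - r = a + b - w" "r' = a + r - w \<Longrightarrow> r' + b - r = a + b - w"
    "a + b - a = b" "a + b - b = a" "(a + b - d) - a - b + d = 0"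
  by (simp_all add: algebra_simps)

lemma group_solve:
  fixes a b d r :: "'a::ab_group_add"
  assumes "a - b - d + r = 0"
  shows "a = b + d - r"
proof -
  have "a = (a - b - d + r) + (b + d - r)" by (simp add: algebra_simps)
  then show ?thesis using assms by simp
qed

lemma group_cancel_sum:
  fixes a b c d :: "'a::ab_group_add"
  assumes "c + b = a + d"
  shows "a - b - c + d = 0"
proof -
  have "a - b - c + d = (a + d) - (c + b)" by (simp add: algebra_simps)
  then show ?thesis using assms by simp
qed

text \<open>A finite type with as many elements as the dimension, to index matrices and apply Cramer's rule.\<close>

typedef (overloaded) 'e basis_index = "Basis :: 'e::euclidean_space set"
  using nonempty_Basis by blast

instance basis_index :: (euclidean_space) finite
proof
  have "UNIV = Abs_basis_index ` (Basis :: 'a set)"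
    by (metis Rep_basis_index Rep_basis_index_inverse UNIV_eq_I image_eqI)
  then show "finite (UNIV :: 'a basis_index set)" by (metis finite_Basis finite_imageI)
qed

lemma sum_basis_index:
  fixes f :: "'e::euclidean_space \<Rightarrow> 'b::comm_monoid_add"
  shows "(\<Sum>i\<in>UNIV. f (Rep_basis_index i)) = (\<Sum>b\<in>Basis. f b)"
proof -
  have "bij_betw Rep_basis_index UNIV (Basis :: 'e set)"
    by (metis type_definition.Rep_range type_definition_basis_index Rep_basis_index_inject bij_betw_def injI)
  then show ?thesis by (rule sum.reindex_bij_betw)
qed

context smooth_mfd
begin

text \<open>By Cramer's rule the solution is a quotient of determinants, and these are polynomials in the
  coefficients.\<close>

lemma smooth_linear_solution:
  fixes M :: "'e \<Rightarrow> 'e \<Rightarrow> 'm \<Rightarrow> real"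
  assumes W: "open W" and M: "\<And>b c. b \<in> Basis \<Longrightarrow> c \<in> Basis \<Longrightarrow> smooth_fun_on A W (M b c)"
    and y: "\<And>b. b \<in> Basis \<Longrightarrow> smooth_fun_on A W (y b)"
    and eq: "\<And>q b. q \<in> W \<Longrightarrow> b \<in> Basis \<Longrightarrow> (\<Sum>c\<in>Basis. M b c q * a c q) = y b q"
    and inj: "\<And>q u. q \<in> W \<Longrightarrow> (\<And>b. b \<in> Basis \<Longrightarrow> (\<Sum>c\<in>Basis. M b c q * u c) = 0) \<Longrightarrow>
      (\<And>c. c \<in> Basis \<Longrightarrow> u c = 0)"
    and b0: "b0 \<in> Basis"
  shows "smooth_fun_on A W (a b0)"
proof -
  define k0 where "k0 = (Abs_basis_index b0 :: 'e basis_index)"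
  have Rk0: "Rep_basis_index k0 = b0" using b0 by (simp add: k0_def Abs_basis_index_inverse)
  have RB: "Rep_basis_index i \<in> Basis" for i :: "'e basis_index" by (rule Rep_basis_index)
  have RA: "Rep_basis_index (Abs_basis_index b) = b" if "b \<in> Basis" for b :: 'e
    using that by (rule Abs_basis_index_inverse)
  define N :: "'m \<Rightarrow> real ^ 'e basis_index ^ 'e basis_index"
    where "N q = (\<chi> i j. M (Rep_basis_index i) (Rep_basis_index j) q)" for q
  define N' :: "'m \<Rightarrow> real ^ 'e basis_index ^ 'e basis_index"
    where "N' q = (\<chi> i j. if j = k0 then y (Rep_basis_index i) q
        else M (Rep_basis_index i) (Rep_basis_index j) q)" for q
  have det_smooth: "smooth_fun_on A W (\<lambda>q. det (L q))"
    if "\<And>i j. smooth_fun_on A W (\<lambda>q. L q $ i $ j)" for L :: "'m \<Rightarrow> real ^ 'e basis_index ^ 'e basis_index"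
    unfolding det_def
    by (intro smooth_fun_on_sum[OF W] smooth_fun_on_mult[OF W] smooth_fun_on_const smooth_fun_on_prod[OF W]
        finite_permutations finite_class.finite_UNIV that)
  have N_mult: "(N q *v u) $ i = (\<Sum>c\<in>Basis. M (Rep_basis_index i) c q * u $ Abs_basis_index c)" for q u i
    by (subst sum_basis_index[symmetric]) (simp add: N_def matrix_vector_mult_def Rep_basis_index_inverse)
  have det_nz: "det (N q) \<noteq> 0" if q: "q \<in> W" for q
  proof -
    have "u = 0" if "N q *v u = 0" for u
    proof -
      have "(\<Sum>c\<in>Basis. M b c q * u $ Abs_basis_index c) = 0" if "b \<in> Basis" for b
        using N_mult[of q u "Abs_basis_index b"] \<open>N q *v u = 0\<close> by (simp add: RA[OF that])
      from inj[OF q this] have "u $ Abs_basis_index c = 0" if "c \<in> Basis" for c using that by blast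
      then show "u = 0" by (metis RB Rep_basis_index_inverse vec_eq_iff zero_index)
    qed
    then show ?thesis
      using invertible_det_nz[of "N q"] invertible_left_inverse[of "N q"] matrix_left_invertible_ker[of "N q"] by blast
  qed
  have sol: "a b0 q = det (N' q) * inverse (det (N q))" if q: "q \<in> W" for q
  proof -
    define u :: "real ^ 'e basis_index" where "u = (\<chi> i. a (Rep_basis_index i) q)"
    have "(N q *v u) $ i = y (Rep_basis_index i) q" for i
      using eq[OF q RB] by (simp add: N_mult u_def RA cong: sum.cong)
    then have "N q *v u = (\<chi> i. y (Rep_basis_index i) q)" by (simp add: vec_eq_iff)
    then have "u = (\<chi> k. det (\<chi> i j. if j = k then (\<chi> i. y (Rep_basis_index i) q) $ i else N q $ i $ j) / det (N q))"
      using cramer[OF det_nz[OF q]] by blast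
    then have "u $ k0 = det (\<chi> i j. if j = k0 then (\<chi> i. y (Rep_basis_index i) q) $ i else N q $ i $ j) / det (N q)"
      by simp
    then show ?thesis by (simp add: u_def Rk0 N'_def N_def divide_inverse cong: if_cong)
  qed
  have "smooth_fun_on A W (\<lambda>q. det (N' q) * inverse (det (N q)))"
  proof (rule smooth_fun_on_mult[OF W])
    show "smooth_fun_on A W (\<lambda>q. det (N' q))"
    proof (rule det_smooth)
      fix i j show "smooth_fun_on A W (\<lambda>q. N' q $ i $ j)"
        by (cases "j = k0") (simp_all add: N'_def M y RB)
    qed
    show "smooth_fun_on A W (\<lambda>q. inverse (det (N q)))"
      by (intro smooth_fun_on_inverse W det_smooth) (simp_all add: N_def M RB det_nz[unfolded N_def])
  qed
  then show ?thesis by (rule smooth_fun_on_cong[OF W, rotated]) (simp add: sol)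
qed

lemma smooth_fun_continuous: "smooth_fun A f \<Longrightarrow> continuous_on UNIV f"
proof -
  assume f: "smooth_fun A f"
  have "isCont f p" for p
  proof -
    obtain U \<phi> where c: "(U, \<phi>) \<in> A" "p \<in> U" by (rule chart_exists)
    have "continuous_on U (\<lambda>q. f (inv_into U \<phi> (\<phi> q)))"
      by (rule continuous_on_compose2[OF smooth_fun_chart_Ck[OF f c(1), of 0, unfolded Ck_on.simps]])
        (use chartD(4)[OF c(1)] in \<open>auto simp: homeomorphism_def\<close>)
    then have "continuous_on U f" using chartD(3)[OF c(1)] by (simp cong: continuous_on_cong)
    then show ?thesis using chartD(1)[OF c(1)] c(2) by (simp add: continuous_on_eq_continuous_at)
  qed
  then show ?thesis by (simp add: continuous_at_imp_continuous_on)
qed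

lemma smooth_fun_support_open: "smooth_fun A f \<Longrightarrow> open {q. f q \<noteq> 0}"
  using open_vimage[OF open_Compl[OF closed_singleton] smooth_fun_continuous, of f 0]
  by (simp add: vimage_def Compl_eq)

lemma vf_tangent: "vector_field A Y \<Longrightarrow> Y p \<in> tangent_space A p"
  by (simp add: vector_field_def)

lemma vf_smooth: "vector_field A Y \<Longrightarrow> smooth_fun A f \<Longrightarrow> smooth_fun A (\<lambda>q. Y q f)"
  by (simp add: vector_field_def)

lemma tangent_space_add: "v \<in> tangent_space A p \<Longrightarrow> w \<in> tangent_space A p \<Longrightarrow> v + w \<in> tangent_space A p"
  using tangent_space_lincomb[of v p w 1 1] by simp

lemma tangent_space_diff: "v \<in> tangent_space A p \<Longrightarrow> w \<in> tangent_space A p \<Longrightarrow> v - w \<in> tangent_space A p"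
  using tangent_space_lincomb[of v p w 1 "-1"] by simp

lemma tangent_space_sum: "(\<And>i. i \<in> I \<Longrightarrow> v i \<in> tangent_space A p) \<Longrightarrow> (\<Sum>i\<in>I. v i) \<in> tangent_space A p"
  by (induction I rule: infinite_finite_induct) (auto intro: tangent_space_add tangent_space_0)

lemma tangent_eqI:
  assumes "v \<in> tangent_space A p" "w \<in> tangent_space A p" "\<And>f. smooth_fun A f \<Longrightarrow> v f = w f"
  shows "v = w"
  using assms tangent_nonsmooth by (metis ext)

lemma vf_add: "vector_field A Y \<Longrightarrow> vector_field A Z \<Longrightarrow> vector_field A (\<lambda>q. Y q + Z q)"
  by (auto simp: vector_field_def plus_fun_apply intro: tangent_space_add smooth_fun_add)

lemma vf_scaleR: "smooth_fun A g \<Longrightarrow> vector_field A Y \<Longrightarrow> vector_field A (\<lambda>q. g q *\<^sub>R Y q)"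
  unfolding vector_field_def
  by (intro conjI allI impI tangent_space_scaleR) (simp_all add: scaleR_fun_def smooth_fun_mult)

lemma vf_0: "vector_field A (\<lambda>q. 0)"
  by (auto simp: vector_field_def intro: tangent_space_0 smooth_fun_const)

lemma vf_sum: "finite I \<Longrightarrow> (\<And>i. i \<in> I \<Longrightarrow> vector_field A (Y i)) \<Longrightarrow> vector_field A (\<lambda>q. \<Sum>i\<in>I. Y i q)"
  by (induction I rule: finite_induct) (auto intro: vf_add vf_0)

lemma bracket_apply:
  "smooth_fun A f \<Longrightarrow> lie_bracket A Y Z p f = Y p (\<lambda>q. Z q f) - Z p (\<lambda>q. Y q f)"
  by (simp add: lie_bracket_def)

lemma vf_bracket:
  assumes Y: "vector_field A Y" and Z: "vector_field A Z"
  shows "vector_field A (lie_bracket A Y Z)"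
  unfolding vector_field_def
proof (intro conjI allI impI)
  fix p
  note [simp] = vf_smooth[OF Y] vf_smooth[OF Z] bracket_apply smooth_fun_mult smooth_fun_lincomb
    tangent_lincomb[OF vf_tangent[OF Y]] tangent_lincomb[OF vf_tangent[OF Z]]
    tangent_mult[OF vf_tangent[OF Y]] tangent_mult[OF vf_tangent[OF Z]]
    tangent_add[OF vf_tangent[OF Y]] tangent_add[OF vf_tangent[OF Z]]
  show "lie_bracket A Y Z p \<in> tangent_space A p"
    by (rule tangent_spaceI) (simp_all add: algebra_simps lie_bracket_def)
next
  fix f assume f: "smooth_fun A f"
  show "smooth_fun A (\<lambda>p. lie_bracket A Y Z p f)"
    by (simp add: bracket_apply f smooth_fun_diff vf_smooth Y Z)
qed

lemma bracket_antisym: "lie_bracket A Y Z p = - lie_bracket A Z Y p"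
  by (rule ext) (simp add: lie_bracket_def)

lemma bracket_self: "lie_bracket A Y Y p = 0"
  by (rule ext) (simp add: lie_bracket_def)

lemma bracket_add_left:
  assumes "vector_field A Y" "vector_field A Y'" "vector_field A Z"
  shows "lie_bracket A (\<lambda>q. Y q + Y' q) Z p = lie_bracket A Y Z p + lie_bracket A Y' Z p"
proof
  fix f
  show "lie_bracket A (\<lambda>q. Y q + Y' q) Z p f = (lie_bracket A Y Z p + lie_bracket A Y' Z p) f"
    using tangent_add[OF vf_tangent[OF assms(3)] vf_smooth[OF assms(1)] vf_smooth[OF assms(2)], of f f p]
    by (simp add: lie_bracket_def plus_fun_apply)
qed

lemma bracket_scale_left:
  assumes Y: "vector_field A Y" and Z: "vector_field A Z" and g: "smooth_fun A g"
  shows "lie_bracket A (\<lambda>q. g q *\<^sub>R Y q) Z p = g p *\<^sub>R lie_bracket A Y Z p - (Z p g) *\<^sub>R Y p"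
proof
  fix f
  show "lie_bracket A (\<lambda>q. g q *\<^sub>R Y q) Z p f = (g p *\<^sub>R lie_bracket A Y Z p - (Z p g) *\<^sub>R Y p) f"
  proof (cases "smooth_fun A f")
    case True
    then show ?thesis
      using tangent_mult[OF vf_tangent[OF Z] g vf_smooth[OF Y True], of p]
      by (simp add: lie_bracket_def scaleR_fun_def algebra_simps)
  next
    case False
    then show ?thesis using tangent_nonsmooth[OF vf_tangent[OF Y] False, of p]
      by (simp add: lie_bracket_def scaleR_fun_def)
  qed
qed

lemma dual_frameD:
  assumes "dual_frame x E \<kappa>"
  shows "\<And>b. b \<in> Basis \<Longrightarrow> smooth_fun A (x b)" "\<And>b. b \<in> Basis \<Longrightarrow> vector_field A (E b)"
    "smooth_fun A \<kappa>"
    "\<And>b b'. b \<in> Basis \<Longrightarrow> b' \<in> Basis \<Longrightarrow> E b q (x b') = (if b = b' then \<kappa> q else 0)"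
  using assms unfolding dual_frame_def by blast+

lemma dual_frame_expand:
  assumes fr: "dual_frame x E \<kappa>" and v: "v \<in> tangent_space A q"
  shows "\<kappa> q *\<^sub>R v = (\<Sum>b\<in>Basis. v (x b) *\<^sub>R E b q)"
proof (rule tangent_eqI[of _ q])
  show "\<kappa> q *\<^sub>R v \<in> tangent_space A q" by (rule tangent_space_scaleR) fact
  show "(\<Sum>b\<in>Basis. v (x b) *\<^sub>R E b q) \<in> tangent_space A q"
    by (intro tangent_space_sum tangent_space_scaleR vf_tangent dual_frameD(2)[OF fr])
  show "(\<kappa> q *\<^sub>R v) f = (\<Sum>b\<in>Basis. v (x b) *\<^sub>R E b q) f" if "smooth_fun A f" for f
    using fr v that unfolding dual_frame_def by (simp add: sum_fun_apply) (simp add: scaleR_fun_def)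
qed

text \<open>Since \<open>\<kappa>(p) = 1\<close>, the value at \<open>Y\<close> equals the value at \<open>\<kappa> Y = (\<Sum>b. Y(x\<^sub>b) E\<^sub>b)\<close>, where only the numbers
  \<open>Y\<^sub>p(x\<^sub>b)\<close> enter.\<close>

lemma tensorial_pointwise:
  fixes \<Phi> :: "'m vfield \<Rightarrow> 'v::real_vector"
  assumes add: "\<And>Y Z. vector_field A Y \<Longrightarrow> vector_field A Z \<Longrightarrow> \<Phi> (\<lambda>q. Y q + Z q) = \<Phi> Y + \<Phi> Z"
    and scale: "\<And>g Y. smooth_fun A g \<Longrightarrow> vector_field A Y \<Longrightarrow> \<Phi> (\<lambda>q. g q *\<^sub>R Y q) = g p *\<^sub>R \<Phi> Y"
    and Y: "vector_field A Y" and Z: "vector_field A Z" and eq: "Y p = Z p"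
  shows "\<Phi> Y = \<Phi> Z"
proof -
  obtain x E \<kappa> where fr: "dual_frame x E \<kappa>" and \<kappa>p: "\<kappa> p = 1"
    using dual_frame_exists by blast
  note E = dual_frameD(2)[OF fr] and x = dual_frameD(1)[OF fr]
  have sum: "\<Phi> (\<lambda>q. \<Sum>i\<in>I. g i q *\<^sub>R F i q) = (\<Sum>i\<in>I. g i p *\<^sub>R \<Phi> (F i))"
    if "finite I" "\<And>i. i \<in> I \<Longrightarrow> smooth_fun A (g i)" "\<And>i. i \<in> I \<Longrightarrow> vector_field A (F i)"
    for I and g :: "'e \<Rightarrow> 'm \<Rightarrow> real" and F
    using that
  proof (induction I)
    case empty
    show ?case using scale[OF smooth_fun_const vf_0, of 0] by (simp add: zero_fun_def)
  next
    case (insert i I)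
    then show ?case
      using add[of "\<lambda>q. g i q *\<^sub>R F i q" "\<lambda>q. \<Sum>i\<in>I. g i q *\<^sub>R F i q"]
      by (simp add: vf_scaleR vf_sum scale)
  qed
  have "\<Phi> Y = (\<Sum>b\<in>Basis. Y p (x b) *\<^sub>R \<Phi> (E b))" if Y: "vector_field A Y" for Y
  proof -
    have "\<Phi> Y = \<Phi> (\<lambda>q. \<kappa> q *\<^sub>R Y q)" using scale[OF dual_frameD(3)[OF fr] Y] \<kappa>p by simp
    also have "(\<lambda>q. \<kappa> q *\<^sub>R Y q) = (\<lambda>q. \<Sum>b\<in>Basis. Y q (x b) *\<^sub>R E b q)"
      by (rule ext, rule dual_frame_expand[OF fr vf_tangent[OF Y]])
    also have "\<Phi> \<dots> = (\<Sum>b\<in>Basis. Y p (x b) *\<^sub>R \<Phi> (E b))"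
      by (rule sum) (use x E Y in \<open>auto intro: vf_smooth\<close>)
    finally show ?thesis .
  qed
  then show ?thesis using Y Z eq by simp
qed

lemma tensor_tangent: "tensor11 A R \<Longrightarrow> v \<in> tangent_space A p \<Longrightarrow> R p v \<in> tangent_space A p"
  unfolding tensor11_def by blast

lemma tensor_lincomb:
  assumes "tensor11 A R" "v \<in> tangent_space A p" "w \<in> tangent_space A p"
  shows "R p (a *\<^sub>R v + b *\<^sub>R w) = a *\<^sub>R R p v + b *\<^sub>R R p w"
  using assms unfolding tensor11_def linear_on_subspace_def by blast

lemma tensor_linear:
  assumes "tensor11 A R" "v \<in> tangent_space A p" "w \<in> tangent_space A p"
  shows "R p (v + w) = R p v + R p w" "R p (v - w) = R p v - R p w"
    "R p (a *\<^sub>R v) = a *\<^sub>R R p v" "R p (- v) = - R p v" "R p 0 = 0"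
  using tensor_lincomb[OF assms, of 1 1] tensor_lincomb[OF assms, of 1 "-1"]
    tensor_lincomb[OF assms, of a 0] tensor_lincomb[OF assms, of "-1" 0] tensor_lincomb[OF assms, of 0 0]
  by simp_all

lemma tensor_linear3:
  assumes "tensor11 A S" "u \<in> tangent_space A p" "v \<in> tangent_space A p" "w \<in> tangent_space A p"
  shows "S p (u + v - w) = S p u + S p v - S p w"
  using tensor_linear(2)[OF assms(1) tangent_space_add[OF assms(2,3)] assms(4)] tensor_linear(1)[OF assms(1-3)]
  by simp

lemma vf_app: "tensor11 A R \<Longrightarrow> vector_field A Y \<Longrightarrow> vector_field A (R \<cdot> Y)"
  by (simp add: tensor11_def)

lemma app_apply: "(R \<cdot> Y) p = R p (Y p)"
  by (simp add: app_field_def)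

lemma tensor_power_tensor:
  assumes R: "tensor11 A R"
  shows "tensor11 A (tensor_power R k)"
proof (induction k)
  case 0
  show ?case by (simp add: tensor11_def tensor_power_def linear_on_subspace_def app_field_def)
next
  case (Suc k)
  have "tensor_power R (Suc k) \<cdot> Y = R \<cdot> (tensor_power R k \<cdot> Y)" for Y
    by (simp add: tensor_power_def app_field_def)
  moreover have "linear_on_subspace (tangent_space A p) (tensor_power R (Suc k) p)" for p
    unfolding linear_on_subspace_def
  proof (intro ballI allI)
    fix v w a b assume v: "v \<in> tangent_space A p" and w: "w \<in> tangent_space A p"
    show "tensor_power R (Suc k) p (a *\<^sub>R v + b *\<^sub>R w) =
        a *\<^sub>R tensor_power R (Suc k) p v + b *\<^sub>R tensor_power R (Suc k) p w"
      using tensor_lincomb[OF Suc v w] tensor_lincomb[OF R tensor_tangent[OF Suc v] tensor_tangent[OF Suc w]]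
      by (simp add: tensor_power_def)
  qed
  ultimately show ?case
    using R Suc unfolding tensor11_def
    by (auto simp: vf_app[OF R] image_subset_iff) (auto simp: tensor_power_def)
qed

lemma power_zero_app: "tensor_power R 0 \<cdot> Y = Y" by (simp add: tensor_power_def app_field_def)

lemma power_Suc_app: "tensor_power R (Suc k) \<cdot> Y = R \<cdot> (tensor_power R k \<cdot> Y)"
  by (simp add: tensor_power_def app_field_def)

lemma tensor_power_0: "tensor_power R 0 p v = v" by (simp add: tensor_power_def)

lemma tensor_power_Suc: "tensor_power R (Suc k) p v = R p (tensor_power R k p v)"
  by (simp add: tensor_power_def)

lemma tensor_power_commute: "tensor_power R k p (R p v) = R p (tensor_power R k p v)"
  by (simp add: tensor_power_def funpow_swap1)

lemma tensor_power_add: "tensor_power R j p (tensor_power R k p v) = tensor_power R (j + k) p v"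
  by (simp add: tensor_power_def funpow_add)

lemma torsion_apply:
  "nijenhuis_torsion A R Y Z p = lie_bracket A (R \<cdot> Y) (R \<cdot> Z) p - R p (lie_bracket A (R \<cdot> Y) Z p)
    - R p (lie_bracket A Y (R \<cdot> Z) p) + R p (R p (lie_bracket A Y Z p))"
  by (simp add: nijenhuis_torsion_def plus_fun_apply app_apply)

lemma torsion_antisym:
  assumes R: "tensor11 A R" and "vector_field A Y" "vector_field A Z"
  shows "nijenhuis_torsion A R Y Z p = - nijenhuis_torsion A R Z Y p"
proof -
  note neg = tensor_linear(4)[OF R vf_tangent[OF vf_bracket] vf_tangent[OF vf_0]]
  have RR: "R p (R p (lie_bracket A Y Z p)) = - R p (R p (lie_bracket A Z Y p))"
    using tensor_linear(4)[OF R tensor_tangent[OF R vf_tangent[OF vf_bracket]] vf_tangent[OF vf_0], of Z Y p]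
    by (subst bracket_antisym) (simp add: neg assms)
  show ?thesis
    unfolding torsion_apply RR
    by (subst (1 2 3) bracket_antisym) (simp add: neg assms vf_app)
qed

text \<open>The torsion is a tensor in its first argument; by antisymmetry this suffices. In \<open>T(gY, Z)\<close> the terms with
  the derivatives of \<open>g\<close> along \<open>Z\<close> and along \<open>RZ\<close> cancel in pairs.\<close>

lemma torsion_pointwise_left:
  assumes R: "tensor11 A R" and Y: "vector_field A Y" "vector_field A Y'" and Z: "vector_field A Z"
    and eq: "Y p = Y' p"
  shows "nijenhuis_torsion A R Y Z p = nijenhuis_torsion A R Y' Z p"
proof (rule tensorial_pointwise[where \<Phi> = "\<lambda>Y. nijenhuis_torsion A R Y Z p" and p = p])
  note cl = vf_tangent vf_bracket vf_app[OF R] Z tensor_tangent[OF R] tangent_space_scaleR tangent_space_add tangent_space_diff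
  fix Y Y' :: "'m vfield" and g assume vf: "vector_field A Y" "vector_field A Y'"
  have "R \<cdot> (\<lambda>q. Y q + Y' q) = (\<lambda>q. (R \<cdot> Y) q + (R \<cdot> Y') q)"
    by (rule ext) (simp add: app_apply tensor_linear[OF R] cl vf)
  then show "nijenhuis_torsion A R (\<lambda>q. Y q + Y' q) Z p = nijenhuis_torsion A R Y Z p + nijenhuis_torsion A R Y' Z p"
    by (simp add: torsion_apply bracket_add_left tensor_linear[OF R] cl vf)
next
  note cl = vf_tangent vf_bracket vf_app[OF R] Z tensor_tangent[OF R] tangent_space_scaleR tangent_space_add tangent_space_diff
  fix Y :: "'m vfield" and g assume g: "smooth_fun A g" and vf: "vector_field A Y"
  have "R \<cdot> (\<lambda>q. g q *\<^sub>R Y q) = (\<lambda>q. g q *\<^sub>R (R \<cdot> Y) q)"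
    by (rule ext) (simp add: app_apply tensor_linear(3)[OF R _ tangent_space_0] cl vf)
  then show "nijenhuis_torsion A R (\<lambda>q. g q *\<^sub>R Y q) Z p = g p *\<^sub>R nijenhuis_torsion A R Y Z p"
    by (simp add: torsion_apply bracket_scale_left g cl vf tensor_linear(2)[OF R]
        tensor_linear(3)[OF R _ tangent_space_0] algebra_simps) (simp add: app_apply)
qed (use assms in auto)

lemma lie_deriv_tensor_apply:
  "lie_deriv_tensor A X R Y p = lie_bracket A X (R \<cdot> Y) p - R p (lie_bracket A X Y p)"
  by (simp add: lie_deriv_tensor_def app_apply)

lemma lie_deriv_pointwise:
  assumes R: "tensor11 A R" and X: "vector_field A X" and Y: "vector_field A Y" "vector_field A Y'" and eq: "Y p = Y' p"
  shows "lie_deriv_tensor A X R Y p = lie_deriv_tensor A X R Y' p"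
proof -
  note cl = vf_tangent vf_bracket vf_app[OF R] X tensor_tangent[OF R] tangent_space_scaleR tangent_space_add tangent_space_diff
  let ?\<Phi> = "\<lambda>Y. lie_bracket A (R \<cdot> Y) X p - R p (lie_bracket A Y X p)"
  have "?\<Phi> Y = ?\<Phi> Y'"
  proof (rule tensorial_pointwise[where \<Phi> = ?\<Phi> and p = p, OF _ _ Y eq])
    fix Y Y' :: "'m vfield" assume vf: "vector_field A Y" "vector_field A Y'"
    have "R \<cdot> (\<lambda>q. Y q + Y' q) = (\<lambda>q. (R \<cdot> Y) q + (R \<cdot> Y') q)"
      by (rule ext) (simp add: app_apply tensor_linear[OF R] cl vf)
    then show "?\<Phi> (\<lambda>q. Y q + Y' q) = ?\<Phi> Y + ?\<Phi> Y'"
      by (simp add: bracket_add_left tensor_linear[OF R] cl vf)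
  next
    fix Y :: "'m vfield" and g assume g: "smooth_fun A g" and vf: "vector_field A Y"
    have "R \<cdot> (\<lambda>q. g q *\<^sub>R Y q) = (\<lambda>q. g q *\<^sub>R (R \<cdot> Y) q)"
      by (rule ext) (simp add: app_apply tensor_linear(3)[OF R _ tangent_space_0] cl vf)
    then show "?\<Phi> (\<lambda>q. g q *\<^sub>R Y q) = g p *\<^sub>R ?\<Phi> Y"
      by (simp add: bracket_scale_left g cl vf tensor_linear(2)[OF R]
          tensor_linear(3)[OF R _ tangent_space_0] algebra_simps) (simp add: app_apply)
  qed
  moreover have "lie_deriv_tensor A X R Y p = - ?\<Phi> Y" if "vector_field A Y" for Y
  proof -
    have "R p (lie_bracket A X Y p) = - R p (lie_bracket A Y X p)"
      by (subst bracket_antisym) (rule tensor_linear(4)[OF R vf_tangent[OF vf_bracket[OF that X]] tangent_space_0])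
    moreover have "- a - (- b) = - (a - b)" for a b :: "'m tvec" by simp
    ultimately show ?thesis
      unfolding lie_deriv_tensor_apply bracket_antisym[of X "R \<cdot> Y"] by (simp only:)
  qed
  ultimately show ?thesis using Y by (simp only:)
qed

section \<open>One-forms and Hamiltonian vector fields\<close>

lemma cotangent_lincomb:
  assumes "\<alpha> \<in> cotangent_space A p" "v \<in> tangent_space A p" "w \<in> tangent_space A p"
  shows "\<alpha> (a *\<^sub>R v + b *\<^sub>R w) = a * \<alpha> v + b * \<alpha> w"
  using assms unfolding cotangent_space_def linear_on_subspace_def by simp

lemma cotangent_linear:
  assumes "\<alpha> \<in> cotangent_space A p" "v \<in> tangent_space A p" "w \<in> tangent_space A p"
  shows "\<alpha> (v + w) = \<alpha> v + \<alpha> w" "\<alpha> (v - w) = \<alpha> v - \<alpha> w" "\<alpha> (a *\<^sub>R v) = a * \<alpha> v"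
  using cotangent_lincomb[OF assms, of 1 1] cotangent_lincomb[OF assms, of 1 "-1"]
    cotangent_lincomb[OF assms, of a 0] by simp_all

lemma cotangent_0: "\<alpha> \<in> cotangent_space A p \<Longrightarrow> \<alpha> 0 = 0"
  using cotangent_lincomb[of \<alpha> p 0 0 0 0] by (simp add: tangent_space_0)

lemma cotangent_sum:
  assumes "\<alpha> \<in> cotangent_space A p" "\<And>i. i \<in> I \<Longrightarrow> v i \<in> tangent_space A p" "finite I"
  shows "\<alpha> (\<Sum>i\<in>I. c i *\<^sub>R v i) = (\<Sum>i\<in>I. c i * \<alpha> (v i))"
  using assms(3,2)
proof (induction I rule: finite_induct)
  case (insert i I)
  then show ?case
    using cotangent_linear(1)[OF assms(1), of "c i *\<^sub>R v i" "\<Sum>i\<in>I. c i *\<^sub>R v i"]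
      cotangent_linear(3)[OF assms(1), of "v i" "v i" "c i"]
    by (simp add: tangent_space_scaleR tangent_space_sum)
qed (simp only: sum.empty cotangent_0[OF assms(1)])

lemma cotangent_eqI:
  assumes "\<alpha> \<in> cotangent_space A p" "\<beta> \<in> cotangent_space A p"
    "\<And>v. v \<in> tangent_space A p \<Longrightarrow> \<alpha> v = \<beta> v"
  shows "\<alpha> = \<beta>"
proof
  fix v show "\<alpha> v = \<beta> v"
    using assms by (cases "v \<in> tangent_space A p") (auto simp: cotangent_space_def)
qed

lemma cotangent_spaceI:
  assumes "\<And>v w a b. v \<in> tangent_space A p \<Longrightarrow> w \<in> tangent_space A p \<Longrightarrow>
      \<alpha> (a *\<^sub>R v + b *\<^sub>R w) = a * \<alpha> v + b * \<alpha> w"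
    "\<And>v. v \<notin> tangent_space A p \<Longrightarrow> \<alpha> v = 0"
  shows "\<alpha> \<in> cotangent_space A p"
  using assms by (simp add: cotangent_space_def linear_on_subspace_def)

lemma differential_apply: "v \<in> tangent_space A p \<Longrightarrow> differential A f p v = v f"
  by (simp add: differential_def)

lemma differential_cotangent: "differential A f p \<in> cotangent_space A p"
  by (rule cotangent_spaceI)
    (simp_all add: differential_apply tangent_space_lincomb, simp_all add: differential_def plus_fun_apply scaleR_fun_def)

lemma differential_one_form: "smooth_fun A f \<Longrightarrow> one_form A (differential A f)"
  by (simp add: one_form_def differential_cotangent differential_apply vf_tangent vf_smooth)

lemma one_form_cotangent: "one_form A \<theta> \<Longrightarrow> \<theta> p \<in> cotangent_space A p"
  by (simp add: one_form_def)

lemma one_form_smooth: "one_form A \<theta> \<Longrightarrow> vector_field A Y \<Longrightarrow> smooth_fun A (\<lambda>p. \<theta> p (Y p))"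
  by (simp add: one_form_def)

lemma differential_closed:
  assumes f: "smooth_fun A f"
  shows "closed_form A (differential A f)"
  unfolding closed_form_def
proof (intro conjI allI impI ext)
  show "one_form A (differential A f)" using f by (rule differential_one_form)
  fix Y Z p assume "vector_field A Y" "vector_field A Z"
  then show "ext_deriv1 A (differential A f) Y Z p = 0 p"
    by (simp add: ext_deriv1_def differential_apply vf_tangent vf_bracket bracket_apply[OF f])
qed

lemma form_comp_apply: "v \<in> tangent_space A p \<Longrightarrow> form_comp A \<theta> R p v = \<theta> p (R p v)"
  by (simp add: form_comp_def)

lemma form_comp_one_form:
  assumes \<theta>: "one_form A \<theta>" and R: "tensor11 A R"
  shows "one_form A (form_comp A \<theta> R)"
  unfolding one_form_def
proof (intro conjI allI impI)
  fix p show "form_comp A \<theta> R p \<in> cotangent_space A p"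
    by (rule cotangent_spaceI)
      (simp_all add: form_comp_apply tangent_space_lincomb tensor_lincomb[OF R]
        cotangent_lincomb[OF one_form_cotangent[OF \<theta>]] tensor_tangent[OF R], simp add: form_comp_def)
next
  fix Y assume Y: "vector_field A Y"
  then show "smooth_fun A (\<lambda>p. form_comp A \<theta> R p (Y p))"
    using one_form_smooth[OF \<theta> vf_app[OF R Y]] by (simp add: form_comp_apply vf_tangent app_apply)
qed

definition hamiltonian :: "'m bivec \<Rightarrow> ('m \<Rightarrow> real) \<Rightarrow> 'm vfield" where
  "hamiltonian P f = (\<lambda>p. P p (differential A f p))"

lemma
  assumes "bivector A P"
  shows bivector_tangent: "\<alpha> \<in> cotangent_space A p \<Longrightarrow> P p \<alpha> \<in> tangent_space A p"
    and bivector_skew: "\<alpha> \<in> cotangent_space A p \<Longrightarrow> \<beta> \<in> cotangent_space A p \<Longrightarrow> \<beta> (P p \<alpha>) = - \<alpha> (P p \<beta>)"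
    and bivector_lincomb: "\<alpha> \<in> cotangent_space A p \<Longrightarrow> \<beta> \<in> cotangent_space A p \<Longrightarrow>
      P p (a *\<^sub>R \<alpha> + b *\<^sub>R \<beta>) = a *\<^sub>R P p \<alpha> + b *\<^sub>R P p \<beta>"
    and bivector_vf: "one_form A \<theta> \<Longrightarrow> vector_field A (\<lambda>p. P p (\<theta> p))"
proof -
  have lin: "linear_on_subspace (cotangent_space A p) (P p)" and im: "P p ` cotangent_space A p \<subseteq> tangent_space A p"
    and skew: "\<forall>\<alpha>\<in>cotangent_space A p. \<forall>\<beta>\<in>cotangent_space A p. \<beta> (P p \<alpha>) = - \<alpha> (P p \<beta>)"
    using assms unfolding bivector_def by simp_all
  show "\<alpha> \<in> cotangent_space A p \<Longrightarrow> P p \<alpha> \<in> tangent_space A p" using im by blast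
  show "\<alpha> \<in> cotangent_space A p \<Longrightarrow> \<beta> \<in> cotangent_space A p \<Longrightarrow> \<beta> (P p \<alpha>) = - \<alpha> (P p \<beta>)"
    using skew by blast
  show "\<alpha> \<in> cotangent_space A p \<Longrightarrow> \<beta> \<in> cotangent_space A p \<Longrightarrow>
      P p (a *\<^sub>R \<alpha> + b *\<^sub>R \<beta>) = a *\<^sub>R P p \<alpha> + b *\<^sub>R P p \<beta>"
    using lin unfolding linear_on_subspace_def by (elim ballE allE) auto
  show "one_form A \<theta> \<Longrightarrow> vector_field A (\<lambda>p. P p (\<theta> p))"
    using assms unfolding bivector_def by simp
qed

lemma hamiltonian_vf: "bivector A P \<Longrightarrow> smooth_fun A f \<Longrightarrow> vector_field A (hamiltonian P f)"
  unfolding hamiltonian_def by (rule bivector_vf[of P "differential A f"], simp_all add: differential_one_form)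

lemma hamiltonian_apply:
  "bivector A P \<Longrightarrow> hamiltonian P f p g = poisson_bracket A P f g p"
  using differential_apply[OF bivector_tangent[of P "differential A f p" p], of g]
  by (simp add: hamiltonian_def poisson_bracket_def differential_cotangent)

lemma poisson_bracket_smooth:
  assumes "bivector A P" "smooth_fun A f" "smooth_fun A g"
  shows "smooth_fun A (poisson_bracket A P f g)"
  using vf_smooth[OF hamiltonian_vf[OF assms(1,2)] assms(3)] by (simp add: hamiltonian_apply[OF assms(1)])

lemma poisson_bracket_skew:
  "bivector A P \<Longrightarrow> poisson_bracket A P f g p = - poisson_bracket A P g f p"
  unfolding poisson_bracket_def
  by (rule bivector_skew[of P "differential A f p" p "differential A g p"]) (simp_all add: differential_cotangent)

text \<open>Evaluated on a function \<open>h\<close>, this is the Jacobi identity for \<open>f\<close>, \<open>g\<close> and \<open>h\<close>.\<close>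

lemma hamiltonian_bracket:
  assumes P: "poisson_bivector A P" and f: "smooth_fun A f" and g: "smooth_fun A g"
  shows "lie_bracket A (hamiltonian P f) (hamiltonian P g) p = hamiltonian P (poisson_bracket A P f g) p"
proof (rule tangent_eqI)
  have b: "bivector A P" using P by (simp add: poisson_bivector_def)
  show "lie_bracket A (hamiltonian P f) (hamiltonian P g) p \<in> tangent_space A p"
    by (intro vf_tangent vf_bracket hamiltonian_vf b f g)
  show "hamiltonian P (poisson_bracket A P f g) p \<in> tangent_space A p"
    by (intro vf_tangent hamiltonian_vf b poisson_bracket_smooth f g)
  fix h assume h: "smooth_fun A h"
  have neg: "poisson_bracket A P g (poisson_bracket A P h f) p = - poisson_bracket A P g (poisson_bracket A P f h) p"
  proof -
    have "poisson_bracket A P h f = (\<lambda>q. (- 1) * poisson_bracket A P f h q)"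
      by (rule ext) (simp add: poisson_bracket_skew[OF b, of h f])
    then show ?thesis
      using tangent_cmul[OF vf_tangent[OF hamiltonian_vf[OF b g]] poisson_bracket_smooth[OF b f h], of p "-1"]
      by (simp add: hamiltonian_apply[OF b])
  qed
  have "(poisson_bracket A P f (poisson_bracket A P g h) + poisson_bracket A P g (poisson_bracket A P h f)
      + poisson_bracket A P h (poisson_bracket A P f g)) p = 0"
    using P f g h by (simp add: poisson_bivector_def)
  then have "poisson_bracket A P f (poisson_bracket A P g h) p - poisson_bracket A P g (poisson_bracket A P f h) p
      = poisson_bracket A P (poisson_bracket A P f g) h p"
    using neg poisson_bracket_skew[OF b, of "poisson_bracket A P f g" h p] by (simp add: plus_fun_apply)
  then show "lie_bracket A (hamiltonian P f) (hamiltonian P g) p h = hamiltonian P (poisson_bracket A P f g) p h"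
    by (simp add: bracket_apply h hamiltonian_apply[OF b])
qed

lemma differential_add:
  assumes "smooth_fun A f" "smooth_fun A g"
  shows "differential A (\<lambda>q. f q + g q) p = 1 *\<^sub>R differential A f p + 1 *\<^sub>R differential A g p"
proof
  fix v
  show "differential A (\<lambda>q. f q + g q) p v = (1 *\<^sub>R differential A f p + 1 *\<^sub>R differential A g p) v"
    using tangent_add[OF _ assms, of v p] by (simp add: differential_def plus_fun_apply)
qed

lemma hamiltonian_add_bivec:
  "hamiltonian (P + Q) f = (\<lambda>q. hamiltonian P f q + hamiltonian Q f q)"
  by (simp only: hamiltonian_def plus_fun_def)

lemma hamiltonian_add_fun:
  assumes "bivector A P" "smooth_fun A f" "smooth_fun A g"
  shows "hamiltonian P (\<lambda>q. f q + g q) p = hamiltonian P f p + hamiltonian P g p"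
  unfolding hamiltonian_def differential_add[OF assms(2,3)]
  using bivector_lincomb[OF assms(1) differential_cotangent[of f p] differential_cotangent[of g p], of 1 1] by simp

text \<open>Polarization: expand the bracket formula for \<open>P + Q\<close> bilinearly and subtract those for
  \<open>P\<close> and \<open>Q\<close>.\<close>

lemma hamiltonian_bracket_mixed:
  assumes P: "poisson_bivector A P" and Q: "poisson_bivector A Q" and PQ: "poisson_bivector A (P + Q)"
    and f: "smooth_fun A f" and g: "smooth_fun A g"
  shows "lie_bracket A (hamiltonian P f) (hamiltonian Q g) p + lie_bracket A (hamiltonian Q f) (hamiltonian P g) p
    = hamiltonian P (poisson_bracket A Q f g) p + hamiltonian Q (poisson_bracket A P f g) p"
proof -
  have bP: "bivector A P" and bQ: "bivector A Q" using P Q by (simp_all add: poisson_bivector_def)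
  note vf = hamiltonian_vf[OF bP f] hamiltonian_vf[OF bQ f] hamiltonian_vf[OF bP g] hamiltonian_vf[OF bQ g]
  note sm = poisson_bracket_smooth[OF bP f g] poisson_bracket_smooth[OF bQ f g]
  have right: "lie_bracket A Y (\<lambda>q. Z q + Z' q) p = lie_bracket A Y Z p + lie_bracket A Y Z' p"
    if "vector_field A Y" "vector_field A Z" "vector_field A Z'" for Y Z Z'
    by (subst (1 2 3) bracket_antisym) (simp add: bracket_add_left that)
  have "poisson_bracket A (P + Q) f g = (\<lambda>q. poisson_bracket A P f g q + poisson_bracket A Q f g q)"
    by (rule ext) (simp add: poisson_bracket_def plus_fun_apply differential_apply bivector_tangent[OF bP]
        bivector_tangent[OF bQ] differential_cotangent tangent_space_add)
  then have "hamiltonian (P + Q) (poisson_bracket A (P + Q) f g) p =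
      hamiltonian P (poisson_bracket A P f g) p + hamiltonian P (poisson_bracket A Q f g) p
      + (hamiltonian Q (poisson_bracket A P f g) p + hamiltonian Q (poisson_bracket A Q f g) p)"
    by (simp add: hamiltonian_add_bivec hamiltonian_add_fun[OF bP sm] hamiltonian_add_fun[OF bQ sm])
  moreover have "lie_bracket A (hamiltonian (P + Q) f) (hamiltonian (P + Q) g) p =
      lie_bracket A (hamiltonian P f) (hamiltonian P g) p + lie_bracket A (hamiltonian P f) (hamiltonian Q g) p
      + (lie_bracket A (hamiltonian Q f) (hamiltonian P g) p + lie_bracket A (hamiltonian Q f) (hamiltonian Q g) p)"
    unfolding hamiltonian_add_bivec by (simp add: bracket_add_left right vf vf_add)
  moreover have "b + c = y + z" if "a + b + (c + d) = a + y + (z + d)" for a b c d y z :: "'m tvec"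
    using that by (metis (no_types) add.assoc add_left_cancel add_right_cancel)
  ultimately show ?thesis
    by (metis (no_types) hamiltonian_bracket[OF PQ f g, of p] hamiltonian_bracket[OF P f g, of p]
        hamiltonian_bracket[OF Q f g, of p])
qed

section \<open>Inverting a nondegenerate bivector\<close>

lemma cotangent_expand:
  assumes fr: "dual_frame x E \<kappa>" and \<alpha>: "\<alpha> \<in> cotangent_space A q" and v: "v \<in> tangent_space A q"
  shows "\<kappa> q * \<alpha> v = (\<Sum>b\<in>Basis. v (x b) * \<alpha> (E b q))"
proof -
  have "\<kappa> q * \<alpha> v = \<alpha> (\<kappa> q *\<^sub>R v)" using cotangent_linear(3)[OF \<alpha> v v] by simp
  also have "\<dots> = (\<Sum>b\<in>Basis. v (x b) * \<alpha> (E b q))"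
    unfolding dual_frame_expand[OF fr v]
    by (rule cotangent_sum[OF \<alpha>]) (simp_all add: vf_tangent dual_frameD(2)[OF fr])
  finally show ?thesis .
qed

lemma tangent_linear_sum:
  fixes x :: "'e \<Rightarrow> 'm \<Rightarrow> real"
  assumes v: "v \<in> tangent_space A p" and x: "\<And>b. b \<in> Basis \<Longrightarrow> smooth_fun A (x b)"
  shows "v (\<lambda>q. \<Sum>b\<in>Basis. u b * x b q) = (\<Sum>b\<in>Basis. u b * v (x b))"
proof -
  have "v (\<lambda>q. \<Sum>b\<in>Basis. u b * x b q) = (\<Sum>b\<in>Basis. v (\<lambda>q. u b * x b q))"
    using tangent_sum[OF v finite_Basis, of "\<lambda>b q. u b * x b q"] x
    by (simp add: smooth_fun_mult smooth_fun_const)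
  also have "\<dots> = (\<Sum>b\<in>Basis. u b * v (x b))"
  proof (rule sum.cong)
    fix b :: 'e assume b: "b \<in> Basis"
    show "v (\<lambda>q. u b * x b q) = u b * v (x b)" by (rule tangent_cmul[OF v x[OF b]])
  qed simp
  finally show ?thesis .
qed

lemma smooth_linear_sum:
  "(\<And>b. b \<in> Basis \<Longrightarrow> smooth_fun A (x b)) \<Longrightarrow> smooth_fun A (\<lambda>q. \<Sum>b\<in>Basis. u b * x b q)"
  by (intro smooth_fun_sum smooth_fun_mult smooth_fun_const) auto

lemma bivector_zero: "bivector A P \<Longrightarrow> P p 0 = 0"
  using bivector_lincomb[of P "differential A undefined p" p "differential A undefined p" 0 0]
  by (simp add: differential_cotangent)

lemma cotangent_space_0: "0 \<in> cotangent_space A p"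
  by (rule cotangent_spaceI) simp_all

lemma cotangent_space_lincomb:
  assumes "\<alpha> \<in> cotangent_space A p" "\<beta> \<in> cotangent_space A p"
  shows "a *\<^sub>R \<alpha> + b *\<^sub>R \<beta> \<in> cotangent_space A p"
proof (rule cotangent_spaceI)
  fix v w c d assume "v \<in> tangent_space A p" "w \<in> tangent_space A p"
  then show "(a *\<^sub>R \<alpha> + b *\<^sub>R \<beta>) (c *\<^sub>R v + d *\<^sub>R w) =
      c * (a *\<^sub>R \<alpha> + b *\<^sub>R \<beta>) v + d * (a *\<^sub>R \<alpha> + b *\<^sub>R \<beta>) w"
    using cotangent_lincomb[OF assms(1), of v w c d] cotangent_lincomb[OF assms(2), of v w c d]
    by (simp only: plus_fun_def scaleR_fun_def) (simp add: algebra_simps)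
next
  fix v assume "v \<notin> tangent_space A p"
  then show "(a *\<^sub>R \<alpha> + b *\<^sub>R \<beta>) v = 0"
    using assms by (simp add: cotangent_space_def plus_fun_apply scaleR_fun_def)
qed

lemma inverse_cotangent:
  assumes "invertible_bivector A P" "v \<in> tangent_space A p"
  shows "bivector_inverse A P p v \<in> cotangent_space A p" "P p (bivector_inverse A P p v) = v"
proof -
  have im: "P p ` cotangent_space A p = tangent_space A p"
    using assms(1) by (simp add: invertible_bivector_def bij_betw_def)
  have v: "v \<in> P p ` cotangent_space A p" unfolding im by (rule assms(2))
  show "bivector_inverse A P p v \<in> cotangent_space A p"
    unfolding bivector_inverse_def by (rule inv_into_into[OF v])
  show "P p (bivector_inverse A P p v) = v"
    unfolding bivector_inverse_def by (rule f_inv_into_f[OF v])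
qed

lemma inverse_bivector_apply:
  assumes "invertible_bivector A P" "\<alpha> \<in> cotangent_space A p"
  shows "bivector_inverse A P p (P p \<alpha>) = \<alpha>"
proof -
  have "inj_on (P p) (cotangent_space A p)"
    using assms(1) by (simp add: invertible_bivector_def bij_betw_def)
  then show ?thesis unfolding bivector_inverse_def using assms(2) by (rule inv_into_f_f)
qed

lemma invertible_inj:
  assumes "invertible_bivector A P" "\<alpha> \<in> cotangent_space A p" "\<beta> \<in> cotangent_space A p" "P p \<alpha> = P p \<beta>"
  shows "\<alpha> = \<beta>"
proof -
  have "inj_on (P p) (cotangent_space A p)"
    using assms(1) by (simp add: invertible_bivector_def bij_betw_def)
  then show ?thesis using assms(4,2,3) by (rule inj_onD)
qed

text \<open>Near a given point, the components \<open>a\<^sub>b = \<alpha>(E\<^sub>b)\<close> of \<open>\<alpha> = P\<inverse>Y\<close> solve a linear system whose matrix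
  consists of the brackets of the coordinate functions. It is regular because \<open>P\<close> is injective: a vector
  \<open>u\<close> in its kernel gives a function \<open>f = (\<Sum>b. u\<^sub>b x\<^sub>b)\<close> with \<open>P(df) = 0\<close>.\<close>

lemma inverse_one_form:
  assumes P: "bivector A P" and inv: "invertible_bivector A P" and Y: "vector_field A Y"
  shows "one_form A (\<lambda>p. bivector_inverse A P p (Y p))"
  unfolding one_form_def
proof (intro conjI allI impI)
  define \<alpha> where "\<alpha> = (\<lambda>q. bivector_inverse A P q (Y q))"
  have \<alpha>: "\<alpha> q \<in> cotangent_space A q" "P q (\<alpha> q) = Y q" for q
    unfolding \<alpha>_def using inverse_cotangent[OF inv vf_tangent[OF Y]] by simp_all
  show "bivector_inverse A P p (Y p) \<in> cotangent_space A p" for p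
    using \<alpha> by (simp add: \<alpha>_def)
  fix Z assume Z: "vector_field A Z"
  have "smooth_fun A (\<lambda>q. \<alpha> q (Z q))"
  proof (rule smooth_fun_local)
    fix p
    obtain x E \<kappa> where fr: "dual_frame x E \<kappa>" and \<kappa>p: "\<kappa> p = 1"
      using dual_frame_exists by blast
    note x = dual_frameD(1)[OF fr] and E = dual_frameD(2)[OF fr] and \<kappa> = dual_frameD(3)[OF fr]
      and dual = dual_frameD(4)[OF fr]
    define W where "W = {q. \<kappa> q \<noteq> 0}"
    have W: "open W" unfolding W_def by (rule smooth_fun_support_open) (rule \<kappa>)
    define M where "M c b q = hamiltonian P (x c) q (x b)" for c b q
    have hx: "vector_field A (hamiltonian P (x c))" if "c \<in> Basis" for c
      using hamiltonian_vf[OF P x[OF that]] .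
    have a_smooth: "smooth_fun_on A W (\<lambda>q. \<alpha> q (E b q))" if b: "b \<in> Basis" for b
    proof (rule smooth_linear_solution[OF W, where M = M and a = "\<lambda>b q. \<alpha> q (E b q)"
          and y = "\<lambda>c q. (- 1) * (\<kappa> q * Y q (x c))" and ?b0.0 = b])
      show "smooth_fun_on A W (M c b)" if "c \<in> Basis" "b \<in> Basis" for c b
        unfolding M_def by (rule smooth_fun_imp_on) (rule vf_smooth[OF hx[OF that(1)] x[OF that(2)]])
      show "smooth_fun_on A W (\<lambda>q. (- 1) * (\<kappa> q * Y q (x c)))" if "c \<in> Basis" for c
        by (intro smooth_fun_imp_on smooth_fun_mult smooth_fun_const \<kappa> vf_smooth[OF Y] x that)
    next
      fix q c :: _ assume c: "(c :: 'e) \<in> Basis"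
      \<comment> \<open>skew-symmetry of \<open>P\<close> for the covectors \<open>dx\<^sub>c\<close> and \<open>\<alpha>\<close>\<close>
      have "\<alpha> q (hamiltonian P (x c) q) = - Y q (x c)"
        using bivector_skew[OF P differential_cotangent[of "x c" q] \<alpha>(1)[of q]]
        by (simp add: hamiltonian_def \<alpha>(2) differential_apply vf_tangent[OF Y])
      then show "(\<Sum>b\<in>Basis. M c b q * \<alpha> q (E b q)) = (- 1) * (\<kappa> q * Y q (x c))"
        using cotangent_expand[OF fr \<alpha>(1)[of q] vf_tangent[OF hx[OF c], of q]] by (simp add: M_def)
    next
      fix q u c assume q: "q \<in> W" and u: "\<And>c. c \<in> Basis \<Longrightarrow> (\<Sum>b\<in>Basis. M c b q * u b) = 0"
        and c: "(c :: 'e) \<in> Basis"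
      define f where "f = (\<lambda>q. \<Sum>b\<in>Basis. u b * x b q)"
      have f: "smooth_fun A f" unfolding f_def by (rule smooth_linear_sum) (rule x)
      define v where "v = hamiltonian P f q"
      have v: "v \<in> tangent_space A q" unfolding v_def by (rule vf_tangent[OF hamiltonian_vf[OF P f]])
      have "v (x c) = 0" if c: "c \<in> Basis" for c
      proof -
        have "v (x c) = - hamiltonian P (x c) q f"
          unfolding v_def hamiltonian_apply[OF P] by (rule poisson_bracket_skew[OF P])
        also have "\<dots> = - (\<Sum>b\<in>Basis. u b * M c b q)"
          unfolding f_def M_def by (rule arg_cong[OF tangent_linear_sum[OF vf_tangent[OF hx[OF c]]]]) (rule x)
        finally show ?thesis using u[OF c] by (simp add: mult.commute)
      qed
      then have "\<kappa> q *\<^sub>R v = 0" unfolding dual_frame_expand[OF fr v] by simp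
      then have "P q (differential A f q) = P q 0"
        using q by (simp add: W_def v_def hamiltonian_def bivector_zero[OF P])
      then have "differential A f q = 0"
        by (rule invertible_inj[OF inv differential_cotangent cotangent_space_0])
      then have "0 = differential A f q (E c q)" by simp
      also have "\<dots> = (\<Sum>b\<in>Basis. u b * E c q (x b))"
        unfolding differential_apply[OF vf_tangent[OF E[OF c]]] f_def
        by (rule tangent_linear_sum[OF vf_tangent[OF E[OF c]]]) (rule x)
      also have "\<dots> = (\<Sum>b\<in>Basis. if c = b then u b * \<kappa> q else 0)"
        by (rule sum.cong) (simp_all add: dual c)
      also have "\<dots> = u c * \<kappa> q" using c by simp
      finally show "u c = 0" using q by (simp add: W_def)
    qed (rule b)
    have "smooth_fun_on A W (\<lambda>q. inverse (\<kappa> q) * (\<Sum>b\<in>Basis. Z q (x b) * \<alpha> q (E b q)))"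
      by (intro smooth_fun_on_mult[OF W] smooth_fun_on_inverse[OF W] smooth_fun_on_sum[OF W] a_smooth
          smooth_fun_imp_on[OF \<kappa>] smooth_fun_imp_on[OF vf_smooth[OF Z x]] finite_Basis) (simp_all add: W_def)
    then have "smooth_fun_on A W (\<lambda>q. \<alpha> q (Z q))"
      by (rule smooth_fun_on_cong[OF W, rotated])
        (simp add: cotangent_expand[OF fr \<alpha>(1) vf_tangent[OF Z], symmetric] W_def)
    then show "\<exists>N. open N \<and> p \<in> N \<and> smooth_fun_on A N (\<lambda>q. \<alpha> q (Z q))"
      using W \<kappa>p by (intro exI[of _ W]) (simp add: W_def)
  qed
  then show "smooth_fun A (\<lambda>p. bivector_inverse A P p (Y p) (Z p))" by (simp add: \<alpha>_def)
qed

text \<open>Every covector at \<open>p\<close> is the differential of a linear combination of coordinates.\<close>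

lemma hamiltonian_spans:
  assumes inv: "invertible_bivector A P" and v: "v \<in> tangent_space A p"
  obtains f where "smooth_fun A f" "hamiltonian P f p = v"
proof -
  obtain x E \<kappa> where fr: "dual_frame x E \<kappa>" and \<kappa>p: "\<kappa> p = 1"
    using dual_frame_exists by blast
  define \<alpha> where "\<alpha> = bivector_inverse A P p v"
  have \<alpha>: "\<alpha> \<in> cotangent_space A p" "P p \<alpha> = v"
    unfolding \<alpha>_def using inverse_cotangent[OF inv v] by simp_all
  define f where "f = (\<lambda>q. \<Sum>b\<in>Basis. \<alpha> (E b p) * x b q)"
  have "differential A f p = \<alpha>"
  proof (rule cotangent_eqI[OF differential_cotangent \<alpha>(1)])
    fix w assume w: "w \<in> tangent_space A p"
    show "differential A f p w = \<alpha> w"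
      using tangent_linear_sum[where x = x and u = "\<lambda>b. \<alpha> (E b p)", OF w dual_frameD(1)[OF fr]] cotangent_expand[OF fr \<alpha>(1) w] \<kappa>p
      by (simp add: differential_apply w f_def mult.commute)
  qed
  moreover have "smooth_fun A f" unfolding f_def by (rule smooth_linear_sum) (rule dual_frameD(1)[OF fr])
  ultimately show ?thesis using that \<alpha>(2) by (simp add: hamiltonian_def)
qed

section \<open>Endomorphisms with vanishing Nijenhuis torsion\<close>

context
  fixes R :: "'m endo"
  assumes R: "tensor11 A R"
    and N: "\<And>Y Z p. vector_field A Y \<Longrightarrow> vector_field A Z \<Longrightarrow> nijenhuis_torsion A R Y Z p = 0"
begin

abbreviation Rp :: "nat \<Rightarrow> 'm endo" where "Rp \<equiv> tensor_power R"

lemma power_tensor: "tensor11 A (Rp k)" by (rule tensor_power_tensor[OF R])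

lemma bracket_RR:
  assumes "vector_field A Y" "vector_field A Z"
  shows "lie_bracket A (R \<cdot> Y) (R \<cdot> Z) p =
    R p (lie_bracket A (R \<cdot> Y) Z p) + R p (lie_bracket A Y (R \<cdot> Z) p) - R p (R p (lie_bracket A Y Z p))"
  by (rule group_solve) (rule N[OF assms, of p, unfolded torsion_apply])

text \<open>Equivalently \<open>\<L>\<^bsub>R\<^sup>iY\<^esub> R = R\<^sup>i \<circ> \<L>\<^sub>Y R\<close>; for \<open>i = 1\<close> this is the vanishing of the torsion.\<close>

lemma bracket_power_R:
  assumes Y: "vector_field A Y" and Z: "vector_field A Z"
  shows "lie_bracket A (Rp i \<cdot> Y) (R \<cdot> Z) p =
    R p (lie_bracket A (Rp i \<cdot> Y) Z p) + Rp i p (lie_bracket A Y (R \<cdot> Z) p) - Rp i p (R p (lie_bracket A Y Z p))"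
proof (induction i)
  case 0
  show ?case unfolding power_zero_app unfolding tensor_power_0 by (rule group_cancel_middle(3)[symmetric])
next
  case (Suc i)
  let ?Y = "Rp i \<cdot> Y"
  note vf = vf_app[OF power_tensor Y] vf_app[OF R Z] Y Z
  note tan = vf_tangent[OF vf_bracket[OF vf(1,4)]] vf_tangent[OF vf_bracket[OF vf(3,2)]] vf_tangent[OF vf_bracket[OF vf(3,4)]]
  have "R p (lie_bracket A ?Y (R \<cdot> Z) p) =
      R p (R p (lie_bracket A ?Y Z p)) + Rp (Suc i) p (lie_bracket A Y (R \<cdot> Z) p)
      - Rp (Suc i) p (R p (lie_bracket A Y Z p))"
    unfolding Suc tensor_power_Suc
    by (intro tensor_linear3[OF R] tensor_tangent[OF R] tensor_tangent[OF power_tensor] tan)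
  then show ?case
    unfolding power_Suc_app bracket_RR[OF vf(1) Z] by (rule group_cancel_middle(1))
qed

text \<open>Equivalently \<open>\<L>\<^bsub>R\<^sup>iY\<^esub> (R\<^sup>j) = R\<^sup>i \<circ> \<L>\<^sub>Y (R\<^sup>j)\<close>, which follows from the case \<open>j = 1\<close> by the Leibniz rule.\<close>

lemma bracket_power_power:
  assumes Y: "vector_field A Y" and Z: "vector_field A Z"
  shows "lie_bracket A (Rp i \<cdot> Y) (Rp j \<cdot> Z) p =
    Rp j p (lie_bracket A (Rp i \<cdot> Y) Z p) + Rp i p (lie_bracket A Y (Rp j \<cdot> Z) p)
    - Rp i p (Rp j p (lie_bracket A Y Z p))"
proof (induction j)
  case 0
  show ?case unfolding power_zero_app unfolding tensor_power_0 by (rule group_cancel_middle(4)[symmetric])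
next
  case (Suc j)
  let ?Z = "Rp j \<cdot> Z"
  note vf = vf_app[OF power_tensor Y] vf_app[OF power_tensor Z] Y Z
  note tan = vf_tangent[OF vf_bracket[OF vf(1,4)]] vf_tangent[OF vf_bracket[OF vf(3,2)]] vf_tangent[OF vf_bracket[OF vf(3,4)]]
  have "R p (lie_bracket A (Rp i \<cdot> Y) ?Z p) =
      Rp (Suc j) p (lie_bracket A (Rp i \<cdot> Y) Z p) + Rp i p (R p (lie_bracket A Y ?Z p))
      - Rp i p (Rp (Suc j) p (lie_bracket A Y Z p))"
    unfolding Suc tensor_power_Suc tensor_power_commute
    by (intro tensor_linear3[OF R] tensor_tangent[OF power_tensor] tan)
  then show ?case
    unfolding power_Suc_app bracket_power_R[OF Y vf(2)] by (rule group_cancel_middle(2))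
qed

lemma power_torsion_zero:
  assumes Y: "vector_field A Y" and Z: "vector_field A Z"
  shows "nijenhuis_torsion A (Rp k) Y Z p = 0"
  unfolding torsion_apply bracket_power_power[OF Y Z, of k k p] by (rule group_cancel_middle(5))

lemma power_haantjes_free: "haantjes_torsion_free A (Rp k)"
  unfolding haantjes_torsion_free_def
proof (intro allI impI)
  fix Y Z assume Y: "vector_field A Y" and Z: "vector_field A Z"
  note T = vf_app[OF power_tensor] Y Z
  have z: "nijenhuis_torsion A (Rp k) V W = 0" if "vector_field A V" "vector_field A W" for V W
    by (rule ext) (rule trans[OF power_torsion_zero[OF that] zero_fun_apply[symmetric]])
  have "(Rp k \<cdot> 0) p = 0 p" for p
    unfolding app_apply
    by (subst (1 2) zero_fun_apply) (rule tensor_linear(5)[OF power_tensor tangent_space_0 tangent_space_0])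
  then have "Rp k \<cdot> 0 = 0" by (rule ext)
  then show "haantjes_torsion A (Rp k) Y Z = 0"
    unfolding haantjes_torsion_def by (simp only: z T diff_0_right add_0_right)
qed

text \<open>For any \<open>\<theta>\<close>, the derivatives \<open>d(\<theta>R\<^sup>2)(Y, Z) + d\<theta>(RY, RZ)\<close> and
  \<open>d(\<theta>R)(RY, Z) + d(\<theta>R)(Y, RZ)\<close> differ by \<open>\<theta>\<close> of the Nijenhuis torsion of \<open>R\<close>.\<close>

lemma closed_form_step:
  assumes \<theta>: "closed_form A \<theta>" and \<theta>R: "closed_form A (form_comp A \<theta> R)"
  shows "closed_form A (form_comp A (form_comp A \<theta> R) R)"
  unfolding closed_form_def
proof (intro conjI allI impI ext)
  have form: "one_form A \<theta>" using \<theta> by (simp add: closed_form_def)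
  then show "one_form A (form_comp A (form_comp A \<theta> R) R)"
    by (intro form_comp_one_form R)
  fix Y Z p assume Y: "vector_field A Y" and Z: "vector_field A Z"
  note vf = Y Z vf_app[OF R Y] vf_app[OF R Z]
  note lin = cotangent_linear[OF one_form_cotangent[OF form]]
  have eval: "form_comp A \<theta> R q v = \<theta> q (R q v)" if "v \<in> tangent_space A q" for q v
    using that by (rule form_comp_apply)
  have d1: "ext_deriv1 A \<theta> (R \<cdot> Y) (R \<cdot> Z) p = 0"
    using \<theta> vf by (simp add: closed_form_def)
  have d2: "ext_deriv1 A (form_comp A \<theta> R) (R \<cdot> Y) Z p = 0" "ext_deriv1 A (form_comp A \<theta> R) Y (R \<cdot> Z) p = 0"
    using \<theta>R vf by (simp_all add: closed_form_def)
  let ?B = "lie_bracket A (R \<cdot> Y) Z p" and ?C = "lie_bracket A Y (R \<cdot> Z) p" and ?D = "lie_bracket A Y Z p"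
  have tan: "?B \<in> tangent_space A p" "?C \<in> tangent_space A p" "?D \<in> tangent_space A p"
    by (intro vf_tangent vf_bracket vf)+
  have "\<theta> p (lie_bracket A (R \<cdot> Y) (R \<cdot> Z) p) = \<theta> p (R p ?B) + \<theta> p (R p ?C) - \<theta> p (R p (R p ?D))"
    unfolding bracket_RR[OF Y Z]
    using lin(2)[of "R p ?B + R p ?C" p "R p (R p ?D)"] lin(1)[of "R p ?B" p "R p ?C"]
    by (simp add: tan tensor_tangent[OF R] tangent_space_add)
  then show "ext_deriv1 A (form_comp A (form_comp A \<theta> R) R) Y Z p = 0 p"
    using d1 d2
    by (simp add: ext_deriv1_def form_comp_apply vf_tangent vf tan tensor_tangent[OF R] app_apply)
qed

lemma closed_form_powers:
  assumes \<theta>: "closed_form A \<theta>" and \<theta>R: "closed_form A (form_comp A \<theta> R)"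
  shows "closed_form A (form_comp A \<theta> (Rp k))"
proof -
  have comp: "form_comp A (form_comp A \<theta> (Rp k)) R = form_comp A \<theta> (Rp (Suc k))" for k
    by (intro ext) (simp add: form_comp_def tensor_tangent[OF R] tensor_power_Suc tensor_power_commute)
  have "form_comp A \<theta> (Rp 0) = \<theta>"
  proof
    have *: "\<theta> p \<in> cotangent_space A p" for p using \<theta> by (auto simp: closed_form_def one_form_cotangent)
    then show "form_comp A \<theta> (Rp 0) p = \<theta> p" for p
      by (auto simp: form_comp_def tensor_power_def fun_eq_iff cotangent_space_def)
  qed
  then have base: "closed_form A (form_comp A \<theta> (Rp 0))" "closed_form A (form_comp A \<theta> (Rp (Suc 0)))"
    using \<theta> \<theta>R comp[of 0] by simp_all
  have "closed_form A (form_comp A \<theta> (Rp k)) \<and> closed_form A (form_comp A \<theta> (Rp (Suc k)))"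
  proof (induction k)
    case (Suc k)
    then show ?case using closed_form_step[of "form_comp A \<theta> (Rp k)"] by (simp add: comp)
  qed (simp add: base)
  then show ?thesis ..
qed

end

end

section \<open>Bi-Hamiltonian vector fields of a Poisson pencil\<close>

locale poisson_pencil = smooth_mfd A
  for A :: "('m::{t2_space, second_countable_topology}, 'e::euclidean_space) chart set" +
  fixes P1 P2 :: "'m bivec"
  assumes P1: "poisson_bivector A P1" and P2: "poisson_bivector A P2"
    and compatible: "poisson_bivector A (P1 + P2)"
    and invertible: "invertible_bivector A P1"
begin

lemma bivectors: "bivector A P1" "bivector A P2"
  using P1 P2 by (simp_all add: poisson_bivector_def)

definition recursion :: "'m endo" where
  "recursion = (\<lambda>p. P2 p \<circ> bivector_inverse A P1 p)"

lemma recursion_apply: "\<alpha> \<in> cotangent_space A p \<Longrightarrow> recursion p (P1 p \<alpha>) = P2 p \<alpha>"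
  by (simp add: recursion_def inverse_bivector_apply[OF invertible])

lemma tangent_is_image:
  assumes "v \<in> tangent_space A p"
  obtains \<alpha> where "\<alpha> \<in> cotangent_space A p" "v = P1 p \<alpha>"
  using inverse_cotangent[OF invertible assms] by metis

lemma recursion_tensor: "tensor11 A recursion"
  unfolding tensor11_def
proof (intro conjI allI impI)
  fix p
  show "linear_on_subspace (tangent_space A p) (recursion p)"
    unfolding linear_on_subspace_def
  proof (intro ballI allI)
    fix v w a b assume "v \<in> tangent_space A p" "w \<in> tangent_space A p"
    then obtain \<alpha> \<beta> where \<alpha>: "\<alpha> \<in> cotangent_space A p" "v = P1 p \<alpha>" and \<beta>: "\<beta> \<in> cotangent_space A p" "w = P1 p \<beta>"
      by (metis tangent_is_image)
    show "recursion p (a *\<^sub>R v + b *\<^sub>R w) = a *\<^sub>R recursion p v + b *\<^sub>R recursion p w"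
      unfolding \<alpha>(2) \<beta>(2) bivector_lincomb[OF bivectors(1) \<alpha>(1) \<beta>(1), symmetric]
        recursion_apply[OF \<alpha>(1)] recursion_apply[OF \<beta>(1)] recursion_apply[OF cotangent_space_lincomb[OF \<alpha>(1) \<beta>(1)]]
      by (rule bivector_lincomb[OF bivectors(2) \<alpha>(1) \<beta>(1)])
  qed
  show "recursion p ` tangent_space A p \<subseteq> tangent_space A p"
  proof
    fix w assume "w \<in> recursion p ` tangent_space A p"
    then obtain v where v: "v \<in> tangent_space A p" "w = recursion p v" by blast
    then show "w \<in> tangent_space A p"
      using bivector_tangent[OF bivectors(2) inverse_cotangent(1)[OF invertible v(1)]] by (simp add: recursion_def)
  qed
next
  fix Y assume Y: "vector_field A Y"
  have "recursion \<cdot> Y = (\<lambda>p. P2 p (bivector_inverse A P1 p (Y p)))"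
    by (simp add: app_field_def recursion_def)
  then show "vector_field A (recursion \<cdot> Y)"
    using bivector_vf[OF bivectors(2) inverse_one_form[OF bivectors(1) invertible Y]] by simp
qed

lemma recursion_hamiltonian_at: "recursion p (hamiltonian P1 f p) = hamiltonian P2 f p"
  by (simp add: hamiltonian_def recursion_apply differential_cotangent)

lemma recursion_hamiltonian: "recursion \<cdot> hamiltonian P1 f = hamiltonian P2 f"
  by (rule ext) (simp only: app_apply recursion_hamiltonian_at)

text \<open>Since \<open>R\<close> maps \<open>P\<^sub>1(df)\<close> to \<open>P\<^sub>2(df)\<close>, the two middle terms of the torsion form \<open>R\<close> of the mixed
  bracket, which cancels the outer terms.\<close>

lemma torsion_hamiltonian:
  assumes f: "smooth_fun A f" and g: "smooth_fun A g"
  shows "nijenhuis_torsion A recursion (hamiltonian P1 f) (hamiltonian P1 g) p = 0"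
proof -
  let ?R = "recursion p" and ?k1 = "poisson_bracket A P1 f g" and ?k2 = "poisson_bracket A P2 f g"
  let ?B = "lie_bracket A (hamiltonian P2 f) (hamiltonian P1 g) p" and ?C = "lie_bracket A (hamiltonian P1 f) (hamiltonian P2 g) p"
  note vf = hamiltonian_vf[OF bivectors(1) f] hamiltonian_vf[OF bivectors(2) f]
    hamiltonian_vf[OF bivectors(1) g] hamiltonian_vf[OF bivectors(2) g]
  note lin = tensor_linear(1)[OF recursion_tensor]
  note k = poisson_bracket_smooth[OF bivectors(1) f g] poisson_bracket_smooth[OF bivectors(2) f g]
  have "?R ?C + ?R ?B = ?R (?C + ?B)"
    by (rule lin[symmetric]) (intro vf_tangent vf_bracket vf)+
  also have "?C + ?B = hamiltonian P1 ?k2 p + hamiltonian P2 ?k1 p"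
    by (rule hamiltonian_bracket_mixed[OF P1 P2 compatible f g])
  also have "?R (hamiltonian P1 ?k2 p + hamiltonian P2 ?k1 p) = ?R (hamiltonian P1 ?k2 p) + ?R (hamiltonian P2 ?k1 p)"
    by (rule lin) (intro vf_tangent hamiltonian_vf bivectors k)+
  also have "\<dots> = hamiltonian P2 ?k2 p + ?R (hamiltonian P2 ?k1 p)"
    unfolding recursion_hamiltonian_at ..
  finally have "?R ?C + ?R ?B = hamiltonian P2 ?k2 p + ?R (hamiltonian P2 ?k1 p)" .
  then show ?thesis
    unfolding torsion_apply recursion_hamiltonian hamiltonian_bracket[OF P1 f g] hamiltonian_bracket[OF P2 f g]
      recursion_hamiltonian_at
    by (rule group_cancel_sum)
qed

lemma recursion_torsion:
  assumes Y: "vector_field A Y" and Z: "vector_field A Z"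
  shows "nijenhuis_torsion A recursion Y Z p = 0"
proof -
  obtain f where f: "smooth_fun A f" "hamiltonian P1 f p = Y p"
    using hamiltonian_spans[OF invertible vf_tangent[OF Y, of p]] by blast
  obtain g where g: "smooth_fun A g" "hamiltonian P1 g p = Z p"
    using hamiltonian_spans[OF invertible vf_tangent[OF Z, of p]] by blast
  note vf = hamiltonian_vf[OF bivectors(1) f(1)] hamiltonian_vf[OF bivectors(1) g(1)]
  have "nijenhuis_torsion A recursion Y Z p = nijenhuis_torsion A recursion (hamiltonian P1 f) Z p"
    by (rule torsion_pointwise_left[OF recursion_tensor Y vf(1) Z f(2)[symmetric]])
  also have "\<dots> = - nijenhuis_torsion A recursion Z (hamiltonian P1 f) p"
    by (rule torsion_antisym[OF recursion_tensor vf(1) Z])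
  also have "nijenhuis_torsion A recursion Z (hamiltonian P1 f) p =
      nijenhuis_torsion A recursion (hamiltonian P1 g) (hamiltonian P1 f) p"
    by (rule torsion_pointwise_left[OF recursion_tensor Z vf(2,1) g(2)[symmetric]])
  also have "\<dots> = 0" by (rule torsion_hamiltonian[OF g(1) f(1)])
  finally show ?thesis by (simp only: minus_zero)
qed

context
  fixes X :: "'m vfield" and H1 H2 :: "'m \<Rightarrow> real"
  assumes H1: "smooth_fun A H1" and H2: "smooth_fun A H2"
    and X1: "X = hamiltonian P1 H1" and X2: "X = hamiltonian P2 H2"
begin

lemma X_vf: "vector_field A X"
  unfolding X1 by (rule hamiltonian_vf[OF bivectors(1) H1])

lemma X_bracket_hamiltonian:
  assumes f: "smooth_fun A f"
  shows "lie_bracket A X (hamiltonian P1 f) p = hamiltonian P1 (\<lambda>q. X q f) p"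
    "lie_bracket A X (hamiltonian P2 f) p = hamiltonian P2 (\<lambda>q. X q f) p"
proof -
  have "poisson_bracket A P1 H1 f = (\<lambda>q. X q f)" by (rule ext) (simp add: X1 hamiltonian_apply[OF bivectors(1)])
  then show "lie_bracket A X (hamiltonian P1 f) p = hamiltonian P1 (\<lambda>q. X q f) p"
    using hamiltonian_bracket[OF P1 H1 f, of p] by (simp add: X1)
  have "poisson_bracket A P2 H2 f = (\<lambda>q. X q f)" by (rule ext) (simp add: X2 hamiltonian_apply[OF bivectors(2)])
  then show "lie_bracket A X (hamiltonian P2 f) p = hamiltonian P2 (\<lambda>q. X q f) p"
    using hamiltonian_bracket[OF P2 H2 f, of p] by (simp add: X2)
qed

text \<open>Both sides depend only on \<open>Y\<^sub>p\<close>, so \<open>Y\<close> may be replaced by a field \<open>P\<^sub>1(df)\<close>; then both sides are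
  \<open>P\<^sub>2(d(Xf))\<close>.\<close>

lemma X_preserves_recursion:
  assumes Y: "vector_field A Y"
  shows "lie_bracket A X (recursion \<cdot> Y) p = recursion p (lie_bracket A X Y p)"
proof -
  obtain f where f: "smooth_fun A f" "hamiltonian P1 f p = Y p"
    using hamiltonian_spans[OF invertible vf_tangent[OF Y, of p]] by blast
  have "lie_deriv_tensor A X recursion Y p = lie_deriv_tensor A X recursion (hamiltonian P1 f) p"
    by (rule lie_deriv_pointwise[OF recursion_tensor X_vf Y hamiltonian_vf[OF bivectors(1) f(1)] f(2)[symmetric]])
  also have "\<dots> = 0"
    unfolding lie_deriv_tensor_apply recursion_hamiltonian X_bracket_hamiltonian[OF f(1)] recursion_hamiltonian_at
    by (rule diff_self)
  finally show ?thesis unfolding lie_deriv_tensor_apply by (simp only: right_minus_eq)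
qed

lemma X_commutes_power: "lie_bracket A X (tensor_power recursion k \<cdot> X) p = 0"
proof (induction k)
  case 0
  show ?case by (simp only: power_zero_app) (rule bracket_self)
next
  case (Suc k)
  show ?case
    unfolding power_Suc_app X_preserves_recursion[OF vf_app[OF tensor_power_tensor[OF recursion_tensor] X_vf]] Suc
    by (rule tensor_linear(5)[OF recursion_tensor tangent_space_0 tangent_space_0])
qed

lemma X_powers_commute:
  "lie_bracket A (tensor_power recursion k \<cdot> X) (tensor_power recursion l \<cdot> X) p = 0"
proof -
  note t = tensor_power_tensor[OF recursion_tensor]
  note z = tensor_linear(5)[OF t tangent_space_0 tangent_space_0]
  have left: "lie_bracket A (tensor_power recursion k \<cdot> X) X p = 0"
    by (subst bracket_antisym) (simp only: X_commutes_power minus_zero)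
  have "lie_bracket A (tensor_power recursion k \<cdot> X) (tensor_power recursion l \<cdot> X) p =
      tensor_power recursion l p 0 + tensor_power recursion k p 0
      - tensor_power recursion k p (tensor_power recursion l p 0)"
    using bracket_power_power[OF recursion_tensor recursion_torsion X_vf X_vf, of k l p]
    by (simp only: left X_commutes_power[of l] bracket_self)
  then show ?thesis by (simp only: z add_0_right diff_0_right)
qed

text \<open>On a tangent vector \<open>P\<^sub>1(\<beta>)\<close> both forms take the value \<open>- \<beta>(X)\<close>, since \<open>X\<close> is Hamiltonian for both
  bivectors.\<close>

lemma differential_H1: "differential A H1 = form_comp A (differential A H2) recursion"
proof (rule ext, rule cotangent_eqI[OF differential_cotangent])
  fix p
  show "form_comp A (differential A H2) recursion p \<in> cotangent_space A p"
    by (rule one_form_cotangent[OF form_comp_one_form[OF differential_one_form[OF H2] recursion_tensor]])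
  fix v assume v: "v \<in> tangent_space A p"
  then obtain \<beta> where \<beta>: "\<beta> \<in> cotangent_space A p" "v = P1 p \<beta>" by (rule tangent_is_image)
  have "differential A H1 p (P1 p \<beta>) = - \<beta> (X p)"
    unfolding X1 hamiltonian_def by (rule bivector_skew[OF bivectors(1) \<beta>(1) differential_cotangent])
  moreover have "differential A H2 p (P2 p \<beta>) = - \<beta> (X p)"
    unfolding X2 hamiltonian_def by (rule bivector_skew[OF bivectors(2) \<beta>(1) differential_cotangent])
  ultimately show "differential A H1 p v = form_comp A (differential A H2) recursion p v"
    unfolding form_comp_apply[OF v] unfolding \<beta>(2) recursion_apply[OF \<beta>(1)] by simp
qed

lemma differential_H1_powers_closed:
  "closed_form A (form_comp A (differential A H1) (tensor_power recursion k))"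
proof -
  have eq: "form_comp A (differential A H1) (tensor_power recursion k) =
      form_comp A (differential A H2) (tensor_power recursion (Suc k))"
    unfolding differential_H1
    by (intro ext) (simp add: form_comp_def tensor_tangent[OF tensor_power_tensor[OF recursion_tensor]] tensor_power_Suc)
  show ?thesis
    unfolding eq by (rule closed_form_powers[OF recursion_tensor recursion_torsion differential_closed[OF H2]])
      (simp_all add: differential_H1[symmetric] differential_closed[OF H1])
qed

lemma X_preserves_differential:
  assumes Y: "vector_field A Y"
  shows "lie_deriv_form A X (differential A H1) Y p = 0"
proof -
  have "X q H1 = 0" for q
    using poisson_bracket_skew[OF bivectors(1), of H1 H1 q] by (simp add: X1 hamiltonian_apply[OF bivectors(1)])
  then show ?thesis
    by (simp add: lie_deriv_form_def differential_apply vf_tangent[OF Y] vf_tangent[OF vf_bracket[OF X_vf Y]]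
        bracket_apply[OF H1] tangent_const[OF vf_tangent[OF Y]])
qed

end

end

theorem mainTheorem1:
  fixes A :: "('m::{t2_space, second_countable_topology}, 'e::euclidean_space) chart set"
    and P1 P2 :: "'m bivec" and R :: "'m endo"
    and X :: "'m vfield" and \<alpha>1 \<alpha>2 \<theta> :: "'m form1"
    and H1 H2 :: "'m \<Rightarrow> real"
  assumes manifold: "smooth_manifold A"
    and P1: "poisson_bivector A P1" and P2: "poisson_bivector A P2"
    and compatible: "poisson_bivector A (P1 + P2)"
    and invertible: "invertible_bivector A P1"
    and R_def: "R = (\<lambda>p. P2 p \<circ> bivector_inverse A P1 p)"
    and X: "vector_field A X"
    and H1: "smooth_fun A H1" and H2: "smooth_fun A H2"
    and \<alpha>1_def: "\<alpha>1 = differential A H1" and \<alpha>2_def: "\<alpha>2 = differential A H2"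
    and bihamiltonian: "X = (\<lambda>p. P1 p (\<alpha>1 p))" "X = (\<lambda>p. P2 p (\<alpha>2 p))"
    and \<theta>_def: "\<theta> = \<alpha>1"
  shows "tensor11 A R \<and>
    (\<forall>k. haantjes_torsion_free A (tensor_power R k)) \<and>
    (\<forall>k l. lie_bracket A (tensor_power R k \<cdot> X) (tensor_power R l \<cdot> X) = 0) \<and>
    (\<forall>k. closed_form A (form_comp A \<theta> (tensor_power R k))) \<and>
    magri_lenard A (\<lambda>k. tensor_power R (k - 1)) X \<theta> \<and>
    (\<forall>Y. vector_field A Y \<longrightarrow> lie_deriv_form A X \<theta> Y = 0) \<and>
    (\<forall>Y. vector_field A Y \<longrightarrow> lie_deriv_tensor A X R Y = 0)"
proof -
  interpret poisson_pencil A P1 P2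
    by unfold_locales (rule manifold P1 P2 compatible invertible)+
  have R: "R = recursion" by (simp add: R_def recursion_def)
  have \<theta>: "\<theta> = differential A H1" by (simp add: \<theta>_def \<alpha>1_def)
  have X1: "X = hamiltonian P1 H1" and X2: "X = hamiltonian P2 H2"
    using bihamiltonian by (simp_all add: hamiltonian_def \<alpha>1_def \<alpha>2_def)
  note tensor = recursion_tensor[folded R]
  have haantjes: "haantjes_torsion_free A (tensor_power R k)" for k
    unfolding R by (rule power_haantjes_free[OF recursion_tensor recursion_torsion])
  have commute: "lie_bracket A (tensor_power R k \<cdot> X) (tensor_power R l \<cdot> X) = 0" for k l
    unfolding R
    by (rule ext) (rule trans[OF X_powers_commute[OF H1 H2 X1 X2] zero_fun_apply[symmetric]])
  have closed: "closed_form A (form_comp A \<theta> (tensor_power R k))" for k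
    unfolding R \<theta> by (rule differential_H1_powers_closed[OF H1 H2 X1 X2])
  have comp: "tensor_comp (tensor_power R k) (tensor_power R l) = tensor_power R (k + l)" for k l
    by (simp add: tensor_comp_def tensor_power_def funpow_add)
  have "magri_lenard A (\<lambda>k. tensor_power R (k - 1)) X \<theta>"
    unfolding magri_lenard_def comp
    using tensor_power_tensor[OF tensor] X commute closed differential_one_form[OF H1]
    by (simp add: \<theta> tensor_power_add add.commute) (simp add: tensor_power_def)
  moreover have "lie_deriv_form A X \<theta> Y = 0" if "vector_field A Y" for Y
    unfolding \<theta>
    by (rule ext) (rule trans[OF X_preserves_differential[OF H1 H2 X1 X2 that] zero_fun_apply[symmetric]])
  moreover have "lie_deriv_tensor A X R Y = 0" if "vector_field A Y" for Y
  proof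
    fix p
    have "lie_deriv_tensor A X R Y p = 0"
      unfolding R lie_deriv_tensor_apply X_preserves_recursion[OF H1 H2 X1 X2 that] by (rule diff_self)
    then show "lie_deriv_tensor A X R Y p = 0 p" by (rule trans[OF _ zero_fun_apply[symmetric]])
  qed
  ultimately show ?thesis
    using tensor haantjes commute closed by blast
qed

end
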